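(* Let $\mathbb{G}$ be a ribbon graph. Then \[ Q(\mathbb{G}; (\boldsymbol\alpha, \boldsymbol\beta, \boldsymbol\gamma) , t) = t^{k(\mathbb{G})}\, Q(Z(\mathbb{G});\mathbf x, t),\] when $\alpha_e=\mathbf x_{\dot{e}}$, $\beta_e=\mathbf x_{\bar{e}}$ and $\gamma_e=\mathbf x_{\hat{e}}$ for each edge $e$ of $\mathbb{G}$.
   Context: A ribbon graph $\mathbb G=(V,E)$ is a surface with boundary given as a union of discs, vertices and edges, meeting in disjoint line segments each on the boundary of one vertex and one edge, each edge containing exactly two such segments. $b(\cdot)$ counts boundary components, $k(\cdot)$ connected components; $\mathbb G\setminus Y$ deletes edges in $Y$; the partial Petrial $\mathbb G^{\tau(Z)}$ detaches one end of each $e\in Z$ and reattaches it with a half-twist. $\mathcal P_3(E)$ is the set of ordered partitions $(X,Y,Z)$ of $E$ into three possibly empty blocks. $Q(\mathbb G;(\boldsymbol\alpha,\boldsymbol\beta,\boldsymbol\gamma),t)=\sum_{(X,Y,Z)\in\mathcal P_3(E)}\prod_{e\in X}\alpha_e\prod_{e\in Y}\beta_e\prod_{e\in Z}\gamma_e\,t^{b(\mathbb G^{\tau(Z)}\setminus Y)}$. $Z(\mathbb G)$ is the $3$-matroid on $U=\{\dot e,\bar e,\hat e:e\in E\}$ with skew classes $\{\dot e,\bar e,\hat e\}$, whose bases are the transversals $\{\dot e:e\in X\}\cup\{\bar e:e\in Y\}\cup\{\hat e:e\in Z\}$ with $b(\mathbb G^{\tau(Z)}\setminus Y)=k(\mathbb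 G)$; its rank function $r$ on subtransversals $S$ is $r(S)=\max_B|B\cap S|$ over bases $B$, and $n(S)=|S|-r(S)$. The weighted transition polynomial of a multimatroid is $Q(Z;\mathbf x,t)=\sum_T t^{n(T)}\prod_{u\in T}\mathbf x_u$ over all transversals $T$. *)

theory Defs
  imports "HOL-Analysis.Analysis"
begin

section \<open>Ribbon graphs\<close>

text \<open>
  A ribbon graph is given by its discs and by the way they are attached to one another.  Every
  vertex disc is a copy of the closed unit disc of the complex plane and every edge disc is a copy
  of the closed unit square, whose left and right sides are the two segments along which the edge
  meets vertices; up to homeomorphism this is no restriction.  The ends of an edge \<open>e\<close> are indexed
  by \<open>bool\<close>.  The end \<open>i\<close> of \<open>e\<close> lies on the vertex \<open>end_vertex G e i\<close>, along the boundary arc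
  \<open>attach G e i\<close> of that disc; the point of the side of the square at height \<open>s\<close> is identified with
  \<open>attach G e i s\<close>.  The surface itself is the quotient space \<open>surface G\<close> below.
\<close>

record ('v, 'e) ribbon_graph =
  verts :: "'v set"
  edges :: "'e set"
  end_vertex :: "'e \<Rightarrow> bool \<Rightarrow> 'v"
  attach :: "'e \<Rightarrow> bool \<Rightarrow> real \<Rightarrow> complex"

definition is_ribbon_graph :: "('v, 'e) ribbon_graph \<Rightarrow> bool" where
  "is_ribbon_graph G \<longleftrightarrow>
     finite (verts G) \<and> finite (edges G) \<and>
     (\<forall>e\<in>edges G. \<forall>i. end_vertex G e i \<in> verts G) \<and>
     (\<forall>e\<in>edges G. \<forall>i. arc (attach G e i) \<and> path_image (attach G e i) \<subseteq> sphere 0 1) \<and>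
     (\<forall>e\<in>edges G. \<forall>e'\<in>edges G. \<forall>i i'.
        (e, i) \<noteq> (e', i') \<longrightarrow> end_vertex G e i = end_vertex G e' i' \<longrightarrow>
        path_image (attach G e i) \<inter> path_image (attach G e' i') = {})"

subsection \<open>The surface\<close>

text \<open>Points of the disjoint union of the discs are pairs of the name of a disc (\<open>Inl\<close> for a
  vertex, \<open>Inr\<close> for an edge) and a point of that disc.\<close>

definition disc :: "'v + 'e \<Rightarrow> complex set" where
  "disc d = (case d of Inl v \<Rightarrow> cball 0 1 | Inr e \<Rightarrow> cbox 0 (Complex 1 1))"

definition disc_names :: "('v, 'e) ribbon_graph \<Rightarrow> ('v + 'e) set" where
  "disc_names G = verts G <+> edges G"

definition discs_topology :: "('v, 'e) ribbon_graph \<Rightarrow> (('v + 'e) \<times> complex) topology" where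
  "discs_topology G = sum_topology (\<lambda>d. top_of_set (disc d)) (disc_names G)"

definition edge_side :: "bool \<Rightarrow> real \<Rightarrow> complex" where
  "edge_side i s = Complex (of_bool i) s"

inductive glued ::
  "('v, 'e) ribbon_graph \<Rightarrow> ('v + 'e) \<times> complex \<Rightarrow> ('v + 'e) \<times> complex \<Rightarrow> bool"
  for G where
  "e \<in> edges G \<Longrightarrow> s \<in> {0..1} \<Longrightarrow>
     glued G (Inl (end_vertex G e i), attach G e i s) (Inr e, edge_side i s)"

definition glue ::
  "('v, 'e) ribbon_graph \<Rightarrow> ('v + 'e) \<times> complex \<Rightarrow> (('v + 'e) \<times> complex) set" where
  "glue G p = {q. equivclp (glued G) p q}"

definition quotient_topology :: "'a topology \<Rightarrow> ('a \<Rightarrow> 'b) \<Rightarrow> 'b topology" where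
  "quotient_topology X f =
     topology (\<lambda>U. U \<subseteq> f ` topspace X \<and> openin X {x \<in> topspace X. f x \<in> U})"

lemma istopology_quotient_topology:
  "istopology (\<lambda>U. U \<subseteq> f ` topspace X \<and> openin X {x \<in> topspace X. f x \<in> U})"
proof -
  have 1: "{x \<in> topspace X. f x \<in> S \<inter> T} = {x \<in> topspace X. f x \<in> S} \<inter> {x \<in> topspace X. f x \<in> T}"
    for S T by auto
  have 2: "{x \<in> topspace X. f x \<in> \<Union>K} = (\<Union>S\<in>K. {x \<in> topspace X. f x \<in> S})" for K
    by auto
  show ?thesis
    unfolding istopology_def 1 2 by blast
qed

lemma openin_quotient_topology:
  "openin (quotient_topology X f) U \<longleftrightarrow>
     U \<subseteq> f ` topspace X \<and> openin X {x \<in> topspace X. f x \<in> U}"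
  unfolding quotient_topology_def by (simp add: istopology_quotient_topology)

lemma topspace_quotient_topology [simp]: "topspace (quotient_topology X f) = f ` topspace X"
proof -
  have "{x \<in> topspace X. f x \<in> f ` topspace X} = topspace X"
    by auto
  then have "openin (quotient_topology X f) (f ` topspace X)"
    by (simp add: openin_quotient_topology)
  then show ?thesis
    by (meson openin_quotient_topology openin_subset openin_topspace subset_antisym)
qed

lemma quotient_map_quotient_topology: "quotient_map X (quotient_topology X f) f"
  by (auto simp: quotient_map_def openin_quotient_topology)

definition surface :: "('v, 'e) ribbon_graph \<Rightarrow> (('v + 'e) \<times> complex) set topology" where
  "surface G = quotient_topology (discs_topology G) (glue G)"

text \<open>The boundary of the surface is what is left of the boundaries of the discs when the interiors
  of the attaching segments are removed.  The end points of the segments stay: they are the corners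
  at which the boundary passes from a vertex to an edge.\<close>

definition surface_boundary :: "('v, 'e) ribbon_graph \<Rightarrow> (('v + 'e) \<times> complex) set set" where
  "surface_boundary G =
     glue G ` (SIGMA d : disc_names G. frontier (disc d)) -
     {glue G (Inr e, edge_side i s) | e i s. e \<in> edges G \<and> 0 < s \<and> s < 1}"

definition num_components :: "('v, 'e) ribbon_graph \<Rightarrow> nat" where
  "num_components G = card (connected_components_of (surface G))"

definition num_boundary_components :: "('v, 'e) ribbon_graph \<Rightarrow> nat" where
  "num_boundary_components G =
     card (connected_components_of (subtopology (surface G) (surface_boundary G)))"

subsection \<open>Edge deletion and partial Petrials\<close>

definition delete_edges :: "('v, 'e) ribbon_graph \<Rightarrow> 'e set \<Rightarrow> ('v, 'e) ribbon_graph" where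
  "delete_edges G Y = G\<lparr>edges := edges G - Y\<rparr>"

text \<open>Reversing the arc along which one end of an edge is attached detaches this end and reattaches
  it with a half-twist.  The end indexed by \<open>True\<close> is used; reflecting the square shows that
  the other choice gives a homeomorphic surface.\<close>

definition partial_petrial :: "('v, 'e) ribbon_graph \<Rightarrow> 'e set \<Rightarrow> ('v, 'e) ribbon_graph" where
  "partial_petrial G Z =
     G\<lparr>attach := \<lambda>e i. if e \<in> Z \<and> i then reversepath (attach G e i) else attach G e i\<rparr>"

lemma is_ribbon_graph_delete_edges: "is_ribbon_graph G \<Longrightarrow> is_ribbon_graph (delete_edges G Y)"
  unfolding is_ribbon_graph_def delete_edges_def by auto

lemma is_ribbon_graph_partial_petrial:
  assumes "is_ribbon_graph G"
  shows "is_ribbon_graph (partial_petrial G Z)"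
proof -
  have "path_image (attach (partial_petrial G Z) e i) = path_image (attach G e i)" for e i
    by (simp add: partial_petrial_def)
  moreover have "arc (attach (partial_petrial G Z) e i)" if "arc (attach G e i)" for e i
    using that by (cases "e \<in> Z \<and> i") (auto simp: partial_petrial_def arc_reversepath)
  moreover have "verts (partial_petrial G Z) = verts G" "edges (partial_petrial G Z) = edges G"
    "end_vertex (partial_petrial G Z) = end_vertex G"
    by (simp_all add: partial_petrial_def)
  ultimately show ?thesis
    using assms unfolding is_ribbon_graph_def by simp
qed

subsection \<open>The transition polynomial of a ribbon graph\<close>

definition ordered_tripartitions :: "'a set \<Rightarrow> ('a set \<times> 'a set \<times> 'a set) set" where
  "ordered_tripartitions E =
     {(X, Y, Z). X \<union> Y \<union> Z = E \<and> X \<inter> Y = {} \<and> X \<inter> Z = {} \<and> Y \<inter> Z = {}}"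

definition state_boundary_components ::
  "('v, 'e) ribbon_graph \<Rightarrow> 'e set \<Rightarrow> 'e set \<Rightarrow> nat" where
  "state_boundary_components G Y Z =
     num_boundary_components (delete_edges (partial_petrial G Z) Y)"

definition ribbon_transition_poly ::
  "('v, 'e) ribbon_graph \<Rightarrow> ('e \<Rightarrow> 'r) \<Rightarrow> ('e \<Rightarrow> 'r) \<Rightarrow> ('e \<Rightarrow> 'r) \<Rightarrow> 'r \<Rightarrow> 'r::comm_ring_1" where
  "ribbon_transition_poly G \<alpha> \<beta> \<gamma> t =
     (\<Sum>(X, Y, Z)\<in>ordered_tripartitions (edges G).
        (\<Prod>e\<in>X. \<alpha> e) * (\<Prod>e\<in>Y. \<beta> e) * (\<Prod>e\<in>Z. \<gamma> e) * t ^ state_boundary_components G Y Z)"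


section \<open>Multimatroids\<close>

text \<open>The data of a multimatroid presented by its bases.\<close>

record 'u multimatroid =
  ground :: "'u set"
  skew_classes :: "'u set set"
  bases :: "'u set set"

definition transversals :: "'u multimatroid \<Rightarrow> 'u set set" where
  "transversals M = {T. T \<subseteq> ground M \<and> (\<forall>\<omega>\<in>skew_classes M. card (T \<inter> \<omega>) = 1)}"

definition mm_rank :: "'u multimatroid \<Rightarrow> 'u set \<Rightarrow> nat" where
  "mm_rank M S = Max {card (B \<inter> S) | B. B \<in> bases M}"

definition mm_nullity :: "'u multimatroid \<Rightarrow> 'u set \<Rightarrow> nat" where
  "mm_nullity M S = card S - mm_rank M S"

definition weighted_transition_poly ::
  "'u multimatroid \<Rightarrow> ('u \<Rightarrow> 'r) \<Rightarrow> 'r \<Rightarrow> 'r::comm_ring_1" where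
  "weighted_transition_poly M x t =
     (\<Sum>T\<in>transversals M. t ^ mm_nullity M T * (\<Prod>u\<in>T. x u))"

subsection \<open>The 3-matroid of a ribbon graph\<close>

datatype 'e element = Dot 'e | Bar 'e | Hat 'e

definition state_transversal :: "'e set \<Rightarrow> 'e set \<Rightarrow> 'e set \<Rightarrow> 'e element set" where
  "state_transversal X Y Z = Dot ` X \<union> Bar ` Y \<union> Hat ` Z"

definition ribbon_multimatroid :: "('v, 'e) ribbon_graph \<Rightarrow> 'e element multimatroid" where
  "ribbon_multimatroid G =
     \<lparr>ground = (\<Union>e\<in>edges G. {Dot e, Bar e, Hat e}),
      skew_classes = (\<lambda>e. {Dot e, Bar e, Hat e}) ` edges G,
      bases = {state_transversal X Y Z | X Y Z.
        (X, Y, Z) \<in> ordered_tripartitions (edges G) \<and>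
        state_boundary_components G Y Z = num_components G}\<rparr>"

end

theory Submission
  imports Defs "HOL-Complex_Analysis.Contour_Integration"
begin

text \<open>
  Remove the open attaching segments of all edges from the vertex circles.  What remains falls into
  connected pieces, arcs whose two ends are corners of edges or whole circles, and the boundary of
  the surface belonging to a state arises from the pieces by joining them with two strands for each
  edge.  The state of an edge only determines which of the three pairings of its four corners the
  strands realise.  Hence the number of boundary components of a state is the number of classes of
  pieces under the relation generated by the strands.

  Every piece has an even number of corners.  By parity, the strands of the other edges connect the
  four corners of an edge either all together or exactly in two pairs.  In the first case all three
  states of the edge give the same number of boundary components; in the second case one state gives
  one component more than the other two, and this happens precisely if the two strands of the edge
  lie on different boundary components.  If no edge has this property, all pieces in one component
  of the ribbon graph are related and the number of boundary components is minimal, namely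
  \<open>k(G)\<close>.  Therefore \<open>b - k(G)\<close> is the least number of edges at which a state has to be changed to
  reach a basis, and this is the nullity of its transversal.
\<close>

section \<open>Counting components\<close>

text \<open>Different states live on different spaces, and a deleted edge is missing from its
  surface altogether. The pieces make states comparable: they are cut out of the vertex circles of
  \<open>G\<close> once, with the arcs of all edges removed, so that every state acts on the same
  finite set. Topology then enters through one principle, that the components of a space with a
  finite closed connected cover are those of the intersection graph of the cover. It serves for
  \<open>k(G)\<close> as well as for boundary components. No cyclic order of the arcs around a
  vertex is recorded. Parity of corners takes over the role of the boundary consisting of closed
  curves, and the linking of all pieces on one vertex circle is read off from the connectedness of
  that circle. States are encoded by nonzero elements of the Klein four-group because the pairs that
  the other edges leave at an edge are again the orbits of such an element \<open>d\<close>. The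
  state \<open>d\<close> only repeats these pairs, while each of the other two states joins
  them.\<close>

lemma quotient_eq_image: "P // R = (\<lambda>p. R `` {p}) ` P"
  by (auto simp: quotient_def)

lemma equiv_rtrancl_sym: "sym R \<Longrightarrow> equiv UNIV (R\<^sup>*)"
  by (simp add: equiv_def refl_rtrancl sym_rtrancl trans_rtrancl)

text \<open>A map respecting the generators sends each class into a single class. The induced map is
  written as a function of the whole class, so that no representative has to be chosen.\<close>

lemma quotient_rtrancl_image:
  assumes f: "f ` P = V" and imp: "\<And>p q. (p, q) \<in> R \<Longrightarrow> (f p, f q) \<in> S\<^sup>*" and "sym S"
  shows "S\<^sup>* `` (f ` (R\<^sup>* `` {p})) = S\<^sup>* `` {f p}"
    and "V // S\<^sup>* = (\<lambda>K. S\<^sup>* `` (f ` K)) ` (P // R\<^sup>*)"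
proof -
  have imp': "(f p, f q) \<in> S\<^sup>*" if "(p, q) \<in> R\<^sup>*" for p q
    using that by induction (auto intro: rtrancl_trans imp)
  show *: "S\<^sup>* `` (f ` (R\<^sup>* `` {p})) = S\<^sup>* `` {f p}" for p
  proof -
    have "S\<^sup>* `` {f q} = S\<^sup>* `` {f p}" if "q \<in> R\<^sup>* `` {p}" for q
      using that imp'[of p q] eq_equiv_class_iff[OF equiv_rtrancl_sym[OF \<open>sym S\<close>], of "f p" "f q"]
      by auto
    moreover have "S\<^sup>* `` (f ` (R\<^sup>* `` {p})) = (\<Union>q \<in> R\<^sup>* `` {p}. S\<^sup>* `` {f q})"
      by auto
    ultimately show ?thesis
      by (auto simp del: Image_singleton_iff)
  qed
  show "V // S\<^sup>* = (\<lambda>K. S\<^sup>* `` (f ` K)) ` (P // R\<^sup>*)"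
    unfolding quotient_eq_image f[symmetric] image_image * ..
qed

lemma card_quotient_rtrancl_le:
  assumes "f ` P = V" "\<And>p q. (p, q) \<in> R \<Longrightarrow> (f p, f q) \<in> S\<^sup>*" "sym S" "finite P"
  shows "card (V // S\<^sup>*) \<le> card (P // R\<^sup>*)"
proof -
  have "V // S\<^sup>* = (\<lambda>K. S\<^sup>* `` (f ` K)) ` (P // R\<^sup>*)"
    by (rule quotient_rtrancl_image) (use assms in auto)
  then show ?thesis
    using \<open>finite P\<close> by (metis card_image_le finite_imageI quotient_eq_image)
qed

text \<open>The induced map of classes is onto; \<open>conv\<close> carries relatedness back along
  \<open>f\<close> and makes it injective.\<close>

lemma card_quotient_rtrancl_eq:
  assumes f: "f ` P = V" and imp: "\<And>p q. (p, q) \<in> R \<Longrightarrow> (f p, f q) \<in> S\<^sup>*" and "sym S"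
    and "sym R"
    and conv: "\<And>p q. p \<in> P \<Longrightarrow> q \<in> P \<Longrightarrow> (f p, f q) \<in> S\<^sup>* \<Longrightarrow> (p, q) \<in> R\<^sup>*"
  shows "card (P // R\<^sup>*) = card (V // S\<^sup>*)"
proof -
  note R = eq_equiv_class_iff[OF equiv_rtrancl_sym[OF \<open>sym R\<close>]]
  note S = eq_equiv_class_iff[OF equiv_rtrancl_sym[OF \<open>sym S\<close>]]
  have 1: "S\<^sup>* `` (f ` (R\<^sup>* `` {p})) = S\<^sup>* `` {f p}" for p
    by (rule quotient_rtrancl_image) (use assms in auto)
  have 2: "V // S\<^sup>* = (\<lambda>K. S\<^sup>* `` (f ` K)) ` (P // R\<^sup>*)"
    by (rule quotient_rtrancl_image) (use assms in auto)
  have "inj_on (\<lambda>K. S\<^sup>* `` (f ` K)) (P // R\<^sup>*)"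
    unfolding quotient_eq_image
    using conv R S 1
    by (auto simp: inj_on_def simp del: Image_singleton_iff)
  then show ?thesis
    unfolding 2 by (simp add: card_image)
qed

section \<open>Components of a space with a finite closed connected cover\<close>

locale closed_connected_cover =
  fixes X :: "'a topology" and P :: "'p set" and C :: "'p \<Rightarrow> 'a set" and R :: "'p rel"
  assumes finite: "finite P"
    and closed: "\<And>p. p \<in> P \<Longrightarrow> closedin X (C p)"
    and connected: "\<And>p. p \<in> P \<Longrightarrow> connectedin X (C p)"
    and nonempty: "\<And>p. p \<in> P \<Longrightarrow> C p \<noteq> {}"
    and cover: "topspace X = (\<Union>p\<in>P. C p)"
    and R_subset: "R \<subseteq> P \<times> P"
    and meet_iff: "\<And>p q. p \<in> P \<Longrightarrow> q \<in> P \<Longrightarrow> C p \<inter> C q \<noteq> {} \<longleftrightarrow> p = q \<or> (p, q) \<in> R"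
begin

lemma sym_R: "sym R"
proof (rule symI)
  fix p q assume "(p, q) \<in> R"
  then have "p \<in> P" "q \<in> P" "C q \<inter> C p \<noteq> {}"
    using R_subset meet_iff[of p q] by auto
  then show "(q, p) \<in> R"
    using meet_iff[of q p] \<open>(p, q) \<in> R\<close> by auto
qed

lemma equiv_R: "equiv UNIV (R\<^sup>*)"
  using sym_R by (auto simp: equiv_def refl_rtrancl sym_rtrancl trans_rtrancl)

lemma rtrancl_in: "(p, q) \<in> R\<^sup>* \<Longrightarrow> p \<in> P \<Longrightarrow> q \<in> P"
  by (induction rule: rtrancl_induct) (use R_subset in auto)

text \<open>This will be the connected component containing \<open>C p\<close>. It is closed as a
  finite union of closed sets, and open because its complement is a finite union of other such
  sets.\<close>

definition D :: "'p \<Rightarrow> 'a set" where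
  "D p = (\<Union>q\<in>R\<^sup>* `` {p}. C q)"

lemma D_disjoint:
  assumes "p \<in> P" "q \<in> P" "(p, q) \<notin> R\<^sup>*"
  shows "D p \<inter> D q = {}"
proof (rule ccontr)
  assume "D p \<inter> D q \<noteq> {}"
  then obtain p' q' where *: "(p, p') \<in> R\<^sup>*" "(q, q') \<in> R\<^sup>*" "C p' \<inter> C q' \<noteq> {}"
    by (auto simp: D_def)
  then have "p' \<in> P" "q' \<in> P"
    using assms rtrancl_in by auto
  then have "(p', q') \<in> R\<^sup>*"
    using meet_iff[of p' q'] * by auto
  moreover have "(q', q) \<in> R\<^sup>*"
    using * sym_R by (meson sym_rtrancl symD)
  ultimately show False
    using * assms by (meson rtrancl_trans)
qed

lemma D_eq_iff:
  assumes "p \<in> P" "q \<in> P"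
  shows "D p = D q \<longleftrightarrow> (p, q) \<in> R\<^sup>*"
proof
  assume "D p = D q"
  moreover have "C p \<subseteq> D p"
    by (auto simp: D_def)
  ultimately show "(p, q) \<in> R\<^sup>*"
    using D_disjoint[OF assms] nonempty[OF assms(1)] by auto
next
  assume "(p, q) \<in> R\<^sup>*"
  then have "R\<^sup>* `` {p} = R\<^sup>* `` {q}"
    using eq_equiv_class_iff[OF equiv_R] by blast
  then show "D p = D q"
    by (simp add: D_def)
qed

lemma D_closed: "p \<in> P \<Longrightarrow> closedin X (D p)"
  unfolding D_def using finite rtrancl_in closed
  by (intro closedin_Union) (auto intro!: finite_imageI intro: finite_subset[of _ P])

lemma D_open:
  assumes "p \<in> P"
  shows "openin X (D p)"
proof -
  have "topspace X - D p = \<Union> (D ` {q \<in> P. (p, q) \<notin> R\<^sup>*})"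
  proof (intro subset_antisym subsetI)
    fix x assume x: "x \<in> topspace X - D p"
    then obtain q where q: "q \<in> P" "x \<in> C q"
      using cover by auto
    then have "x \<in> D q" "(p, q) \<notin> R\<^sup>*"
      using x by (auto simp: D_def)
    then show "x \<in> \<Union> (D ` {q \<in> P. (p, q) \<notin> R\<^sup>*})"
      using q by auto
  next
    fix x assume "x \<in> \<Union> (D ` {q \<in> P. (p, q) \<notin> R\<^sup>*})"
    then obtain q where "q \<in> P" "(p, q) \<notin> R\<^sup>*" "x \<in> D q"
      by auto
    then show "x \<in> topspace X - D p"
      using D_disjoint[of p q] assms D_closed[of q] by (auto dest: closedin_subset)
  qed
  moreover have "closedin X (\<Union> (D ` {q \<in> P. (p, q) \<notin> R\<^sup>*}))"
    by (rule closedin_Union) (use finite D_closed in auto)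
  ultimately show ?thesis
    using D_closed[OF assms] by (simp add: openin_closedin_eq closedin_subset)
qed

lemma component_eq_D:
  assumes "p \<in> P" "x \<in> C p"
  shows "connected_component_of_set X x = D p"
proof
  have x: "x \<in> topspace X"
    using assms cover by auto
  \<comment> \<open>Along a chain in \<open>R\<close> consecutive members share a point
    \<open>y\<close>, so they stay in one component.\<close>
  have "C q \<subseteq> connected_component_of_set X x" if "(p, q) \<in> R\<^sup>*" for q
    using that
  proof induction
    case base
    then show ?case
      using connected[OF assms(1)] assms(2) by (rule connected_component_of_maximal)
  next
    case (step q r)
    then have qr: "q \<in> P" "r \<in> P"
      using R_subset by auto
    then obtain y where y: "y \<in> C q" "y \<in> C r"
      using meet_iff[of q r] step by auto
    have "C r \<subseteq> connected_component_of_set X y"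
      using connected[OF qr(2)] y(2) by (rule connected_component_of_maximal)
    moreover have "connected_component_of_set X y = connected_component_of_set X x"
      using y(1) step.IH by (metis connected_component_of_equiv mem_Collect_eq subsetD)
    ultimately show ?case
      by simp
  qed
  then show "D p \<subseteq> connected_component_of_set X x"
    by (auto simp: D_def)
  have "x \<in> D p"
    using assms by (auto simp: D_def)
  moreover have "x \<in> connected_component_of_set X x"
    using x by (simp add: connected_component_of_refl)
  ultimately show "connected_component_of_set X x \<subseteq> D p"
    using connectedin_clopen_cases[OF connectedin_connected_component_of D_closed[OF assms(1)]
        D_open[OF assms(1)], of x]
    by (auto simp: disjnt_def)
qed

lemma card_components: "card (connected_components_of X) = card (P // R\<^sup>*)"
proof -
  have "connected_components_of X = D ` P"
    unfolding connected_components_of_def cover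
    using component_eq_D nonempty by (auto simp: image_iff) (metis ex_in_conv)
  moreover have "card (D ` P) = card ((\<lambda>p. R\<^sup>* `` {p}) ` P)"
  proof -
    have "inj_on (\<lambda>K. \<Union> (C ` K)) ((\<lambda>p. R\<^sup>* `` {p}) ` P)"
      using D_eq_iff eq_equiv_class_iff[OF equiv_R] unfolding D_def
      by (auto simp: inj_on_def simp del: Image_singleton_iff)
    moreover have "D ` P = (\<lambda>K. \<Union> (C ` K)) ` ((\<lambda>p. R\<^sup>* `` {p}) ` P)"
      by (auto simp: D_def simp del: Image_singleton_iff)
    ultimately show ?thesis
      by (simp add: card_image)
  qed
  ultimately show ?thesis
    by (simp add: quotient_eq_image)
qed

text \<open>A connected set cannot leave the clopen set \<open>D p\<close>. In this direction a
  connected subset of the space produces chains in \<open>R\<close>.\<close>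

lemma related_if_connected:
  assumes "connectedin X S" and p: "p \<in> P" "S \<inter> C p \<noteq> {}" and q: "q \<in> P" "S \<inter> C q \<noteq> {}"
  shows "(p, q) \<in> R\<^sup>*"
proof -
  have sub: "C r \<subseteq> D r" for r
    by (auto simp: D_def)
  have "S \<subseteq> D p"
    using connectedin_clopen_cases[OF assms(1) D_closed D_open] p sub[of p] by (auto simp: disjnt_def)
  then have "D p \<inter> D q \<noteq> {}"
    using q sub[of q] by auto
  then show ?thesis
    using D_disjoint p q by auto
qed

end

section \<open>Strand systems\<close>

text \<open>A new pair unites two classes if they were distinct and has no effect otherwise. The
  correction term stands on the left to avoid truncated subtraction.\<close>

lemma card_quotient_rtrancl_merge:
  assumes "sym R" "finite P" "a \<in> P" "b \<in> P"
  shows "card (P // (R \<union> {(a, b), (b, a)})\<^sup>*) + (if (a, b) \<in> R\<^sup>* then 0 else 1) = card (P // R\<^sup>*)"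
proof -
  let ?S = "R \<union> {(a, b), (b, a)}"
  let ?A = "R\<^sup>* `` {a}" and ?B = "R\<^sup>* `` {b}"
  note R = equiv_rtrancl_sym[OF \<open>sym R\<close>]
  note Req = eq_equiv_class_iff[OF R]
  have sy: "(p, q) \<in> R\<^sup>* \<Longrightarrow> (q, p) \<in> R\<^sup>*" for p q
    using \<open>sym R\<close> by (meson sym_rtrancl symD)
  show ?thesis
  proof (cases "(a, b) \<in> R\<^sup>*")
    case True
    then have "?S\<^sup>* = R\<^sup>*"
      using sy by (intro rtrancl_subset) auto
    then show ?thesis
      using True by simp
  next
    case False
    then have AB: "?A \<noteq> ?B"
      using Req by auto
    have S: "?S = insert (a, b) (insert (b, a) R)"
      by auto
    have cls: "?S\<^sup>* `` {p} = (if R\<^sup>* `` {p} \<in> {?A, ?B} then ?A \<union> ?B else R\<^sup>* `` {p})" for p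
    proof -
      have "(p, q) \<in> ?S\<^sup>* \<longleftrightarrow> (p, q) \<in> R\<^sup>* \<or>
          ((p, a) \<in> R\<^sup>* \<or> (p, b) \<in> R\<^sup>*) \<and> ((a, q) \<in> R\<^sup>* \<or> (b, q) \<in> R\<^sup>*)" for q
        unfolding S rtrancl_insert by (auto intro: rtrancl_trans dest: sy)
      then have "?S\<^sup>* `` {p} = R\<^sup>* `` {p} \<union> (if (p, a) \<in> R\<^sup>* \<or> (p, b) \<in> R\<^sup>* then ?A \<union> ?B else {})"
        by auto
      then show ?thesis
        using Req[of p a] Req[of p b] by (auto simp del: Image_singleton_iff)
    qed
    have "P // ?S\<^sup>* = insert (?A \<union> ?B) (P // R\<^sup>* - {?A, ?B})"
      unfolding quotient_eq_image cls using assms(3) by auto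
    moreover have "?A \<union> ?B \<notin> P // R\<^sup>*"
    proof
      assume "?A \<union> ?B \<in> P // R\<^sup>*"
      then obtain p where "?A \<union> ?B = R\<^sup>* `` {p}"
        by (auto simp: quotient_eq_image)
      then have "a \<in> R\<^sup>* `` {p}" "b \<in> R\<^sup>* `` {p}"
        by auto
      then show False
        using False sy by (auto intro: rtrancl_trans)
    qed
    moreover have "finite (P // R\<^sup>*)" "{?A, ?B} \<subseteq> P // R\<^sup>*"
      using assms by (auto simp: quotient_eq_image)
    moreover have "card (P // R\<^sup>*) \<ge> card {?A, ?B}"
      using calculation by (intro card_mono) auto
    ultimately show ?thesis
      using False AB by (auto simp: card_Diff_subset)
  qed
qed

lemma sym_Un_pair: "sym R \<Longrightarrow> sym (R \<union> {(a, b), (b, a)})"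
  by (auto simp: sym_def)

text \<open>The case of the state \<open>d\<close>: both strands of the edge join corners that are
  related already.\<close>

lemma card_quotient_rtrancl_two_related:
  assumes "sym R" "finite P" "{a, b, c, d} \<subseteq> P" "(a, b) \<in> R\<^sup>*" "(c, d) \<in> R\<^sup>*"
  shows "card (P // (R \<union> {(a, b), (b, a)} \<union> {(c, d), (d, c)})\<^sup>*) = card (P // R\<^sup>*)"
  using card_quotient_rtrancl_merge[OF assms(1,2), of a b]
    card_quotient_rtrancl_merge[OF sym_Un_pair[OF assms(1)] assms(2), of c d a b] assms
    subsetD[OF rtrancl_mono[OF Un_upper1[of R "{(a, b), (b, a)}"]] assms(5)] by auto

text \<open>The case of a state running across the pairs: once the first strand is added, the second
  joins related points. So two strands cost at most one class, which is why changing one edge shifts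
  the count by at most one.\<close>

lemma card_quotient_rtrancl_two_merged:
  assumes "sym R" "finite P" "{a, b, c, d} \<subseteq> P" "(a, b) \<in> R\<^sup>*" "(c, d) \<in> R\<^sup>*"
  shows "card (P // (R \<union> {(a, c), (c, a)} \<union> {(b, d), (d, b)})\<^sup>*) + (if (a, c) \<in> R\<^sup>* then 0 else 1) =
    card (P // R\<^sup>*)"
proof -
  let ?S = "R \<union> {(a, c), (c, a)}"
  have "(a, b) \<in> ?S\<^sup>*" "(c, d) \<in> ?S\<^sup>*"
    using assms rtrancl_mono[of R ?S] by auto
  moreover have "sym (?S\<^sup>*)"
    using sym_Un_pair[OF assms(1)] by (rule sym_rtrancl)
  moreover have "(a, c) \<in> ?S\<^sup>*"
    by auto
  ultimately have "(b, d) \<in> ?S\<^sup>*"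
    by (meson rtrancl_trans symD)
  then show ?thesis
    using card_quotient_rtrancl_merge[OF assms(1,2), of a c]
      card_quotient_rtrancl_merge[OF sym_Un_pair[OF assms(1)] assms(2), of b d a c] assms
    by auto
qed

lemma even_card_fixpoint_free_involution:
  assumes "finite A" "\<And>x. x \<in> A \<Longrightarrow> f x \<in> A" "\<And>x. x \<in> A \<Longrightarrow> f (f x) = x" "\<And>x. x \<in> A \<Longrightarrow> f x \<noteq> x"
  shows "even (card A)"
  using assms
proof (induction "card A" arbitrary: A rule: less_induct)
  case less
  show ?case
  proof (cases "A = {}")
    case False
    then obtain x where x: "x \<in> A"
      by auto
    let ?B = "A - {x, f x}"
    have sub: "{x, f x} \<subseteq> A" and two: "card {x, f x} = 2"
      using x less.prems(2)[OF x] less.prems(4)[OF x, symmetric] by auto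
    have "card A = card ?B + 2"
      using sub two less.prems(1) card_mono[OF less.prems(1) sub] by (simp add: card_Diff_subset)
    moreover have "even (card ?B)"
    proof (rule less.hyps)
      show "f y \<in> ?B" if "y \<in> ?B" for y
        using that less.prems x by auto (metis less.prems(3))+
    qed (use less.prems calculation in auto)
    ultimately show ?thesis
      by simp
  qed simp
qed

section \<open>Corners, their pairings and the classes of pieces they generate\<close>

type_synonym 'e corner = "'e \<times> bool \<times> bool"

text \<open>A corner \<^term>\<open>(e, i, j)\<close> is the end \<open>j\<close> of the segment along which the end \<open>i\<close> of the edge
  \<open>e\<close> is attached.  In each of the three states of \<open>e\<close> its four corners are joined in pairs by two
  strands; the pairing is translation by a nonzero element of the Klein four-group.\<close>

definition partner :: "('e \<Rightarrow> bool \<times> bool) \<Rightarrow> 'e corner \<Rightarrow> 'e corner" where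
  "partner \<tau> c = (case c of (e, i, j) \<Rightarrow> (e, i \<noteq> fst (\<tau> e), j \<noteq> snd (\<tau> e)))"

lemma partner_simps [simp]:
  "partner \<tau> (e, i, j) = (e, i \<noteq> fst (\<tau> e), j \<noteq> snd (\<tau> e))"
  "fst (partner \<tau> c) = fst c"
  "partner \<tau> (partner \<tau> c) = c"
  by (auto simp: partner_def split: prod.splits)

text \<open>This is all that the counting argument retains of a ribbon graph. The fibre of a piece
  is the set of its corners: none for a whole circle, two for an arc.\<close>

locale strand_system =
  fixes E :: "'e set" and P :: "'p set" and \<pi> :: "'e corner \<Rightarrow> 'p"
  assumes finite_E: "finite E" and finite_P: "finite P"
    and \<pi>_in: "\<And>c. fst c \<in> E \<Longrightarrow> \<pi> c \<in> P"
    and even_fibre: "\<And>p. p \<in> P \<Longrightarrow> even (card {c \<in> E \<times> UNIV. \<pi> c = p})"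
begin

definition strands :: "('e \<Rightarrow> bool \<times> bool) \<Rightarrow> 'e set \<Rightarrow> 'p rel" where
  "strands \<tau> A = (\<lambda>c. (\<pi> c, \<pi> (partner \<tau> c))) ` {c. fst c \<in> A}"

definition N :: "('e \<Rightarrow> bool \<times> bool) \<Rightarrow> nat" where
  "N \<tau> = card (P // (strands \<tau> E)\<^sup>*)"

text \<open>The zero element would join every corner to itself; excluding it makes
  \<open>partner\<close> free of fixed points. States are total functions, so the condition also
  covers arguments outside \<open>E\<close>.\<close>

definition valid :: "('e \<Rightarrow> bool \<times> bool) \<Rightarrow> bool" where
  "valid \<tau> \<longleftrightarrow> (\<forall>e. \<tau> e \<noteq> (False, False))"

lemma sym_strands: "sym (strands \<tau> A)"
proof (rule symI)
  fix p q assume "(p, q) \<in> strands \<tau> A"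
  then obtain c where "fst c \<in> A" "p = \<pi> c" "q = \<pi> (partner \<tau> c)"
    by (auto simp: strands_def)
  then show "(q, p) \<in> strands \<tau> A"
    unfolding strands_def by (intro image_eqI[of _ _ "partner \<tau> c"]) auto
qed

lemma strands_subset: "strands \<tau> E \<subseteq> P \<times> P"
  using \<pi>_in by (auto simp: strands_def)

text \<open>Count the corners lying on the class of \<open>p\<close>. Their total is even because
  every fibre is, and those of the other edges are paired off by \<open>partner\<close>, which never
  leaves the class. The rest belongs to \<open>e\<close>.\<close>

lemma even_corners_in_class:
  assumes "valid \<tau>" "e \<in> E" "p \<in> P"
  shows "even (card {(i, j). (p, \<pi> (e, i, j)) \<in> (strands \<tau> (E - {e}))\<^sup>*})"
proof -
  let ?R = "(strands \<tau> (E - {e}))\<^sup>*"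
  let ?K = "{q \<in> P. (p, q) \<in> ?R}"
  let ?D = "\<lambda>A. {c \<in> A \<times> UNIV. \<pi> c \<in> ?K}"
  have "?D E = (\<Union>q\<in>?K. {c \<in> E \<times> UNIV. \<pi> c = q})"
    by auto
  then have "card (?D E) = (\<Sum>q\<in>?K. card {c \<in> E \<times> UNIV. \<pi> c = q})"
    by (simp only:) (rule card_UN_disjoint, use finite_P finite_E in auto)
  then have "even (card (?D E))"
    using even_fibre by (auto intro: dvd_sum)
  moreover have "even (card (?D (E - {e})))"
  proof (rule even_card_fixpoint_free_involution[where f = "partner \<tau>"])
    show "partner \<tau> c \<in> ?D (E - {e})" if c: "c \<in> ?D (E - {e})" for c
    proof -
      have "(\<pi> c, \<pi> (partner \<tau> c)) \<in> strands \<tau> (E - {e})"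
        using c by (auto simp: strands_def)
      then show ?thesis
        using c \<pi>_in[of "partner \<tau> c"]
        by (auto intro: rtrancl_into_rtrancl)
    qed
    show "partner \<tau> c \<noteq> c" for c
    proof -
      obtain f i j where "c = (f, i, j)"
        by (rule prod_cases3)
      then show ?thesis
        using assms(1) by (cases "\<tau> f") (auto simp: valid_def)
    qed
    show "finite (?D (E - {e}))"
      by (rule finite_subset[of _ "E \<times> UNIV"]) (use finite_E in auto)
  qed auto
  moreover have "card (?D E) = card (?D (E - {e})) + card (?D {e})"
  proof -
    have "?D E = ?D (E - {e}) \<union> ?D {e}"
      using assms by auto
    moreover have "finite (?D E)"
      by (rule finite_subset[of _ "E \<times> UNIV"]) (use finite_E in auto)
    ultimately show ?thesis
      by (simp only:) (rule card_Un_disjoint, auto)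
  qed
  moreover have "card (?D {e}) = card {(i, j). (p, \<pi> (e, i, j)) \<in> ?R}"
  proof -
    have "?D {e} = Pair e ` {(i, j). (p, \<pi> (e, i, j)) \<in> ?R}"
      using \<pi>_in[of "(e, _, _)"] assms by auto
    then show ?thesis
      by (simp add: card_image inj_on_def)
  qed
  ultimately show ?thesis
    by simp
qed

text \<open>By parity every class contains none, two or four of the corners of \<open>e\<close>. A
  partition of the four-group into two pairs consists of the cosets of a subgroup of order two, and
  \<open>d\<close> generates it. If all four corners are related, any nonzero \<open>d\<close> would
  do.\<close>

lemma corner_pattern:
  assumes "valid \<tau>" "e \<in> E"
  obtains d where "d \<noteq> (False, False)"
    "\<And>i j. (\<pi> (e, i, j), \<pi> (e, i \<noteq> fst d, j \<noteq> snd d)) \<in> (strands \<tau> (E - {e}))\<^sup>*"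
proof -
  let ?R = "(strands \<tau> (E - {e}))\<^sup>*"
  define K where "K i j = ?R `` {\<pi> (e, i, j)}" for i j
  define r where "r i j i' j' \<longleftrightarrow> (\<pi> (e, i, j), \<pi> (e, i', j')) \<in> ?R" for i j i' j'
  have r: "r i j i' j' \<longleftrightarrow> K i j = K i' j'" for i j i' j'
    unfolding r_def K_def using eq_equiv_class_iff[OF equiv_rtrancl_sym[OF sym_strands]] by blast
  have ev: "even (card {(i', j'). r i j i' j'})" for i j
    unfolding r_def using even_corners_in_class[OF assms, of "\<pi> (e, i, j)"] \<pi>_in[of "(e, i, j)"] assms
    by simp
  have card4: "card {(i', j'). r i j i' j'} =
    of_bool (r i j False False) + of_bool (r i j False True) + of_bool (r i j True False) +
    of_bool (r i j True True)" for i j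
  proof -
    let ?A = "{(i', j'). r i j i' j'}"
    have "card ?A = (\<Sum>x\<in>UNIV. of_bool (x \<in> ?A))"
      by simp
    also have "(UNIV :: (bool \<times> bool) set) = {(False, False), (False, True), (True, False), (True, True)}"
      by auto
    finally show ?thesis
      by simp
  qed
  \<comment> \<open>A partition of four points with a block of odd size has at least two points in
    odd blocks, so evenness at three of the points already excludes it.\<close>
  have pairing: "A = C \<and> B = D \<or> A = B \<and> C = D \<or> A = D \<and> B = C"
    if "even (of_bool (A = A) + of_bool (A = B) + of_bool (A = C) + of_bool (A = D) :: nat)"
      "even (of_bool (B = A) + of_bool (B = B) + of_bool (B = C) + of_bool (B = D) :: nat)"
      "even (of_bool (C = A) + of_bool (C = B) + of_bool (C = C) + of_bool (C = D) :: nat)"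
    for A B C D :: "'p set"
    using that
    by (cases "A = B"; cases "A = C"; cases "A = D"; cases "B = C"; cases "B = D"; cases "C = D"; simp)
  have "K False False = K True False \<and> K False True = K True True \<or>
      K False False = K False True \<and> K True False = K True True \<or>
      K False False = K True True \<and> K False True = K True False"
    by (rule pairing) (fact ev[unfolded card4, unfolded r])+
  then have "\<exists>d. d \<noteq> (False, False) \<and> (\<forall>i j. r i j (i \<noteq> fst d) (j \<noteq> snd d))"
    unfolding r by (simp add: all_bool_eq ex_bool_eq) metis
  then show thesis
    using that unfolding r_def by blast
qed

lemma strands_cong: "(\<And>e. e \<in> A \<Longrightarrow> \<tau> e = \<tau>' e) \<Longrightarrow> strands \<tau> A = strands \<tau>' A"
  unfolding strands_def by (rule image_cong) (auto simp: partner_def)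

definition edge_pairs :: "'e \<Rightarrow> bool \<times> bool \<Rightarrow> 'p rel" where
  "edge_pairs e s = (\<lambda>(i, j). (\<pi> (e, i, j), \<pi> (e, i \<noteq> fst s, j \<noteq> snd s))) ` UNIV"

text \<open>Writing \<open>0\<close> for \<open>(False, False)\<close>, the four corners are
  \<open>0\<close>, \<open>d\<close>, \<open>s\<close> and \<open>d + s\<close>, and translation by
  \<open>s\<close> pairs \<open>0\<close> with \<open>s\<close> and \<open>d\<close> with
  \<open>d + s\<close>. Each strand occurs in both directions.\<close>

lemma edge_pairs_eq:
  assumes "d \<noteq> (False, False)" "s \<noteq> (False, False)" "s \<noteq> d"
  shows "edge_pairs e s =
      {(\<pi> (e, False, False), \<pi> (e, s)), (\<pi> (e, s), \<pi> (e, False, False))} \<union>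
      {(\<pi> (e, d), \<pi> (e, fst d \<noteq> fst s, snd d \<noteq> snd s)),
       (\<pi> (e, fst d \<noteq> fst s, snd d \<noteq> snd s), \<pi> (e, d))}"
  using assms unfolding edge_pairs_def UNIV_Times_UNIV[symmetric] UNIV_bool
  by (cases d; cases s; cases "fst d"; cases "snd d"; cases "fst s"; cases "snd s") auto

lemma klein_four_cases:
  assumes "d \<noteq> (False, False)" "s \<noteq> (False, False)" "s \<noteq> d"
  shows "c = (False, False) \<or> c = d \<or> c = s \<or> c = (fst d \<noteq> fst s, snd d \<noteq> snd s)"
  using assms by (cases d; cases s; cases c) auto

lemma strands_fun_upd:
  assumes "e \<in> E"
  shows "strands (\<tau>(e := s)) E = strands \<tau> (E - {e}) \<union> edge_pairs e s"
proof -
  have "{c. fst c \<in> E} = {c. fst c \<in> E - {e}} \<union> Pair e ` UNIV"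
    using assms by auto
  then have "strands (\<tau>(e := s)) E = strands (\<tau>(e := s)) (E - {e}) \<union>
      (\<lambda>c. (\<pi> c, \<pi> (partner (\<tau>(e := s)) c))) ` Pair e ` UNIV"
    unfolding strands_def by (metis image_Un)
  then show ?thesis
    using strands_cong[of "E - {e}" "\<tau>(e := s)" \<tau>]
    by (simp add: edge_pairs_def image_image split_def partner_def)
qed

text \<open>Without the strands of \<open>e\<close> there are \<open>N0\<close> classes. The state
  \<open>d\<close> follows the pairs of \<open>corner_pattern\<close> and keeps this number, whereas
  the other two states join the pairs and lower it by \<open>\<delta>\<close>, which is 1 if the
  pairs were unrelated. By the last two conclusions, corners of \<open>e\<close> can be unrelated
  only if \<open>\<delta> = 1\<close> and the state is \<open>d\<close>.\<close>

lemma N_fun_upd: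
  assumes "valid \<tau>" "e \<in> E"
  obtains d N0 \<delta> where "d \<noteq> (False, False)" "\<delta> \<le> 1"
    "N (\<tau>(e := d)) = N0" "\<And>s. s \<noteq> (False, False) \<Longrightarrow> s \<noteq> d \<Longrightarrow> N (\<tau>(e := s)) + \<delta> = N0"
    "\<And>c c'. \<delta> = 0 \<Longrightarrow> (\<pi> (e, c), \<pi> (e, c')) \<in> (strands \<tau> E)\<^sup>*"
    "\<And>s c c'. s \<noteq> (False, False) \<Longrightarrow> s \<noteq> d \<Longrightarrow>
       (\<pi> (e, c), \<pi> (e, c')) \<in> (strands (\<tau>(e := s)) E)\<^sup>*"
proof -
  let ?R = "strands \<tau> (E - {e})"
  define y where "y c = \<pi> (e, c)" for c
  have yP: "y c \<in> P" for c
    using assms \<pi>_in[of "(e, c)"] by (simp add: y_def)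
  obtain d where d: "d \<noteq> (False, False)"
    "\<And>i j. (y (i, j), y (i \<noteq> fst d, j \<noteq> snd d)) \<in> ?R\<^sup>*"
    using corner_pattern[OF assms] unfolding y_def by blast
  obtain s0 where s0: "s0 \<noteq> (False, False)" "s0 \<noteq> d"
    by (metis prod.inject)
  define \<delta> :: nat where "\<delta> = (if \<forall>c c'. (y c, y c') \<in> ?R\<^sup>* then 0 else 1)"
  have rel0: "(y (False, False), y d) \<in> ?R\<^sup>*"
    using d(2)[of False False] by simp
  have rel: "(y s, y (fst d \<noteq> fst s, snd d \<noteq> snd s)) \<in> ?R\<^sup>*" for s
    using d(2)[of "fst s" "snd s"] by (simp add: eq_commute)
  \<comment> \<open>The known pairs are \<open>0, d\<close> and \<open>s, d + s\<close>, so a single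
    link from \<open>0\<close> to \<open>s\<close> ties all four corners together.\<close>
  have all_related: "(y c, y c') \<in> S\<^sup>*"
    if S: "?R \<subseteq> S" "sym S" and s: "s \<noteq> (False, False)" "s \<noteq> d" "(y (False, False), y s) \<in> S\<^sup>*" for S s c c'
  proof -
    have sub: "?R\<^sup>* \<subseteq> S\<^sup>*"
      using S(1) by (rule rtrancl_mono)
    have "(y (False, False), y c) \<in> S\<^sup>*" for c
      using klein_four_cases[OF d(1) s(1,2), of c] sub rel0 rel[of s] s(3)
      by (elim disjE) (auto intro: rtrancl_trans)
    moreover have "(y c, y (False, False)) \<in> S\<^sup>*"
      using calculation[of c] S(2) by (meson sym_rtrancl symD)
    ultimately show ?thesis
      by (meson rtrancl_trans)
  qed
  have N: "N (\<tau>(e := s)) = card (P // (?R \<union> edge_pairs e s)\<^sup>*)" for s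
    by (simp add: N_def strands_fun_upd assms)
  \<comment> \<open>Here \<open>d\<close> is the state and \<open>s0\<close> only the auxiliary
    second generator; the two strands of \<open>d\<close> are the known relations
    \<open>rel0\<close> and \<open>rel\<close>.\<close>
  have N_d: "N (\<tau>(e := d)) = card (P // ?R\<^sup>*)"
    unfolding N edge_pairs_eq[OF s0(1) d(1) s0(2)[symmetric]] y_def[symmetric] Un_assoc[symmetric]
    using rel0 rel[of s0]
    by (intro card_quotient_rtrancl_two_related[OF sym_strands finite_P]) (auto simp: yP eq_commute)
  have N_s: "N (\<tau>(e := s)) + \<delta> = card (P // ?R\<^sup>*)" if s: "s \<noteq> (False, False)" "s \<noteq> d" for s
  proof -
    have "\<delta> = (if (y (False, False), y s) \<in> ?R\<^sup>* then 0 else 1)"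
      using all_related[OF order_refl sym_strands s] by (auto simp: \<delta>_def simp del: split_paired_All)
    then show ?thesis
      unfolding N edge_pairs_eq[OF d(1) s] y_def[symmetric] Un_assoc[symmetric]
      using rel0 rel[of s]
      by (simp only:) (intro card_quotient_rtrancl_two_merged[OF sym_strands finite_P], auto simp: yP)
  qed
  show thesis
  proof (rule that[OF d(1) _ N_d N_s])
    show "\<delta> \<le> 1"
      by (simp add: \<delta>_def)
    show "(\<pi> (e, c), \<pi> (e, c')) \<in> (strands \<tau> E)\<^sup>*" if "\<delta> = 0" for c c'
    proof -
      have "?R \<subseteq> strands \<tau> E"
        by (auto simp: strands_def)
      then show ?thesis
        using that rtrancl_mono[of ?R "strands \<tau> E"] unfolding \<delta>_def y_def
        by (simp del: split_paired_All split: if_splits) blast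
    qed
    show "(\<pi> (e, c), \<pi> (e, c')) \<in> (strands (\<tau>(e := s)) E)\<^sup>*"
      if s: "s \<noteq> (False, False)" "s \<noteq> d" for s c c'
      using all_related[OF _ sym_strands s, of "\<tau>(e := s)" E c c'] edge_pairs_eq[OF d(1) s]
      by (auto simp: strands_fun_upd assms y_def)
  qed
qed

text \<open>The old and the new state of an edge both give \<open>N0\<close> or
  \<open>N0 - 1\<close>, so each corrected edge changes \<open>N\<close> by at most one. This is the
  source of the upper bound on ranks.\<close>

lemma N_le_card_diff:
  assumes "valid \<tau>" "valid \<tau>'"
  shows "N \<tau> \<le> N \<tau>' + card {e \<in> E. \<tau> e \<noteq> \<tau>' e}"
  using assms
proof (induction "card {e \<in> E. \<tau> e \<noteq> \<tau>' e}" arbitrary: \<tau>)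
  case 0
  then have "{e \<in> E. \<tau> e \<noteq> \<tau>' e} = {}"
    using finite_E by simp
  then have "N \<tau> = N \<tau>'"
    unfolding N_def by (metis (mono_tags, lifting) empty_Collect_eq strands_cong)
  then show ?case
    by simp
next
  case (Suc n)
  then obtain e where e: "e \<in> E" "\<tau> e \<noteq> \<tau>' e"
    by (metis (mono_tags, lifting) Zero_not_Suc card.empty empty_Collect_eq)
  let ?\<sigma> = "\<tau>(e := \<tau>' e)"
  have "{f \<in> E. \<tau> f \<noteq> \<tau>' f} = insert e {f \<in> E. ?\<sigma> f \<noteq> \<tau>' f}"
    using e by auto
  then have n: "n = card {f \<in> E. ?\<sigma> f \<noteq> \<tau>' f}"
    using Suc.hyps(2) finite_E by simp
  have v: "valid ?\<sigma>"
    using Suc.prems by (auto simp: valid_def)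
  obtain d N0 \<delta> where d: "\<delta> \<le> (1::nat)" "N (\<tau>(e := d)) = N0"
    "\<And>s. s \<noteq> (False, False) \<Longrightarrow> s \<noteq> d \<Longrightarrow> N (\<tau>(e := s)) + \<delta> = N0"
    using N_fun_upd[OF Suc.prems(1) e(1)] by metis
  have le: "N (\<tau>(e := s)) \<le> N0 \<and> N0 \<le> N (\<tau>(e := s)) + 1" if "s \<noteq> (False, False)" for s
    using d(1,2) d(3)[OF that] by (cases "s = d") auto
  have "N \<tau> \<le> N0" "N0 \<le> N ?\<sigma> + 1"
    using le[of "\<tau> e"] le[of "\<tau>' e"] Suc.prems by (auto simp: valid_def)
  then show ?case
    using Suc.hyps(1)[OF n v Suc.prems(2)] n Suc.hyps(2) by linarith
qed

text \<open>Greedy descent. While \<open>N\<close> exceeds \<open>k\<close>, \<open>eq\<close>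
  supplies an edge with unrelated corners. Its state must be the exceptional \<open>d\<close> with
  \<open>\<delta> = 1\<close>, so either of the other two states lowers \<open>N\<close> by exactly
  one. Later \<open>k\<close> is the number of components of the ribbon graph.\<close>

lemma exists_closest_state:
  assumes "valid \<tau>"
    and ge: "\<And>\<sigma>. valid \<sigma> \<Longrightarrow> k \<le> N \<sigma>"
    and eq: "\<And>\<sigma>. valid \<sigma> \<Longrightarrow>
      (\<And>e c c'. e \<in> E \<Longrightarrow> (\<pi> (e, c), \<pi> (e, c')) \<in> (strands \<sigma> E)\<^sup>*) \<Longrightarrow> N \<sigma> = k"
  shows "\<exists>\<sigma>. valid \<sigma> \<and> N \<sigma> = k \<and> card {e \<in> E. \<sigma> e \<noteq> \<tau> e} \<le> N \<tau> - k"
  using assms(1)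
proof (induction "N \<tau> - k" arbitrary: \<tau>)
  case 0
  then have "N \<tau> = k"
    using ge[of \<tau>] by simp
  then show ?case
    using 0 by (intro exI[of _ \<tau>]) simp
next
  case (Suc n)
  then have "N \<tau> \<noteq> k"
    by auto
  then obtain e c c' where e: "e \<in> E" "(\<pi> (e, c), \<pi> (e, c')) \<notin> (strands \<tau> E)\<^sup>*"
    using eq[OF Suc.prems] by metis
  obtain d N0 \<delta> where d: "d \<noteq> (False, False)" "\<delta> \<le> (1::nat)" "N (\<tau>(e := d)) = N0"
    "\<And>s. s \<noteq> (False, False) \<Longrightarrow> s \<noteq> d \<Longrightarrow> N (\<tau>(e := s)) + \<delta> = N0"
    "\<And>c c'. \<delta> = 0 \<Longrightarrow> (\<pi> (e, c), \<pi> (e, c')) \<in> (strands \<tau> E)\<^sup>*"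
    "\<And>s c c'. s \<noteq> (False, False) \<Longrightarrow> s \<noteq> d \<Longrightarrow>
       (\<pi> (e, c), \<pi> (e, c')) \<in> (strands (\<tau>(e := s)) E)\<^sup>*"
    by (rule N_fun_upd[OF Suc.prems e(1)]) (rule that; assumption)
  have "\<delta> = 1"
    using d(2) d(5)[of c c'] e(2) by (cases "\<delta> = 0") auto
  moreover have "\<tau> e = d"
  proof (rule ccontr)
    assume "\<tau> e \<noteq> d"
    moreover have "\<tau> e \<noteq> (False, False)"
      using Suc.prems by (simp add: valid_def)
    ultimately show False
      using d(6)[of "\<tau> e" c c'] e(2) by simp
  qed
  then have "N \<tau> = N0"
    using d(3) by auto
  moreover obtain s where s: "s \<noteq> (False, False)" "s \<noteq> d"
    by (metis prod.inject)
  ultimately have N: "N (\<tau>(e := s)) + 1 = N \<tau>"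
    using d(4)[OF s] by simp
  have v: "valid (\<tau>(e := s))"
    using Suc.prems s by (auto simp: valid_def)
  have "n = N (\<tau>(e := s)) - k"
    using N Suc.hyps(2) by simp
  from Suc.hyps(1)[OF this v] obtain \<sigma> where
    \<sigma>: "valid \<sigma>" "N \<sigma> = k" "card {f \<in> E. \<sigma> f \<noteq> (\<tau>(e := s)) f} \<le> N (\<tau>(e := s)) - k"
    by blast
  have "{f \<in> E. \<sigma> f \<noteq> \<tau> f} \<subseteq> insert e {f \<in> E. \<sigma> f \<noteq> (\<tau>(e := s)) f}"
    by auto
  then have "card {f \<in> E. \<sigma> f \<noteq> \<tau> f} \<le> card (insert e {f \<in> E. \<sigma> f \<noteq> (\<tau>(e := s)) f})"
    by (rule card_mono[rotated]) (use finite_E in auto)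
  also have "\<dots> \<le> Suc (card {f \<in> E. \<sigma> f \<noteq> (\<tau>(e := s)) f})"
    by (rule card_insert_le_m1) auto
  also have "\<dots> \<le> N \<tau> - k"
    using \<sigma>(3) N ge[OF v] by linarith
  finally show ?case
    using \<sigma> by blast
qed

end

section \<open>Circles with disjoint arcs removed\<close>

text \<open>Pulled back along \<open>g\<close>, the path \<open>h\<close> becomes an injective
  continuous map into the unit interval, and its image is the interval between its end values. The
  ends are compared as sets because \<open>h\<close> may run against \<open>g\<close>.\<close>

lemma subarc_parameters:
  fixes g h :: "real \<Rightarrow> complex"
  assumes g: "arc g" and h: "arc h" and sub: "path_image h \<subseteq> path_image g"
  obtains s t where "0 \<le> s" "s < t" "t \<le> 1" "{g s, g t} = {h 0, h 1}"
    "h ` {0<..<1} = g ` {s<..<t}"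
proof -
  obtain g' where g': "homeomorphism {0..1} (path_image g) g g'"
    using homeomorphism_arc[OF g] .
  define \<phi> where "\<phi> = g' \<circ> h"
  have h01: "h u \<in> path_image g" if "u \<in> {0..1}" for u
    using sub that by (auto simp: path_image_def)
  have g\<phi>: "g (\<phi> u) = h u" if "u \<in> {0..1}" for u
    using g' h01[OF that] by (simp add: \<phi>_def homeomorphism_def)
  have \<phi>01: "\<phi> u \<in> {0..1}" if "u \<in> {0..1}" for u
    using g' h01[OF that] by (auto simp: \<phi>_def homeomorphism_def)
  have cont: "continuous_on {0..1} \<phi>"
    unfolding \<phi>_def
  proof (rule continuous_on_compose)
    show "continuous_on {0..1} h"
      using h by (simp add: arc_def path_def)
    show "continuous_on (h ` {0..1}) g'"
      using g' h01 by (auto simp: homeomorphism_def intro: continuous_on_subset)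
  qed
  have inj: "inj_on \<phi> {0..1}"
    using g\<phi> h unfolding arc_def inj_on_def by metis
  have seg: "\<phi> ` {0..1} = closed_segment (\<phi> 0) (\<phi> 1)"
    using continuous_injective_image_segment_1[of 0 1 \<phi>] cont inj by (simp add: closed_segment_eq_real_ivl)
  define s t where "s = min (\<phi> 0) (\<phi> 1)" and "t = max (\<phi> 0) (\<phi> 1)"
  have "\<phi> 0 \<noteq> \<phi> 1"
    using inj by (auto dest: inj_onD)
  then have st: "s < t" "{s, t} = {\<phi> 0, \<phi> 1}"
    by (auto simp: s_def t_def)
  have im: "\<phi> ` {0..1} = {s..t}"
    unfolding seg s_def t_def by (auto simp: closed_segment_eq_real_ivl)
  have "{0<..<1} = {0..1} - {0, 1::real}"
    by auto
  then have "\<phi> ` {0<..<1} = \<phi> ` {0..1} - {\<phi> 0, \<phi> 1}"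
    using inj_on_image_set_diff[OF inj, of "{0..1}" "{0, 1}"] by simp
  also have "\<dots> = {s<..<t}"
    unfolding im st(2)[symmetric] by auto
  finally have "g ` {s<..<t} = g ` \<phi> ` {0<..<1}"
    by simp
  also have "\<dots> = h ` {0<..<1}"
    unfolding image_image by (rule image_cong) (use g\<phi> in auto)
  finally have "h ` {0<..<1} = g ` {s<..<t}" ..
  moreover have "{g s, g t} = {h 0, h 1}"
  proof -
    have "{g s, g t} = g ` {s, t}"
      by simp
    then show ?thesis
      unfolding st(2) by (simp add: g\<phi>)
  qed
  moreover have "0 \<le> s" "t \<le> 1"
    using \<phi>01[of 0] \<phi>01[of 1] by (auto simp: s_def t_def)
  ultimately show thesis
    using that st(1) by blast
qed

text \<open>The ends of \<open>h\<close> cut the circle into two arcs. The open arc is connected and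
  misses both ends, so it lies in one of the two. A subarc with the same ends fills that arc, and
  the other one is the complement.\<close>

lemma circle_minus_open_arc:
  fixes h :: "real \<Rightarrow> complex"
  assumes h: "arc h" "path_image h \<subseteq> sphere 0 1"
  obtains d where "arc d" "path_image d = sphere 0 1 - h ` {0<..<1}" "{d 0, d 1} = {h 0, h 1}"
proof -
  note result = that
  let ?c = "circlepath 0 1"
  have c: "path_image ?c = sphere 0 1"
    by (simp add: path_image_circlepath)
  have ends: "h 0 \<in> path_image h" "h 1 \<in> path_image h" "h 0 \<noteq> h 1"
    using arc_distinct_ends[OF h(1)] by (auto simp: path_image_def pathstart_def pathfinish_def)
  obtain u d where ud: "arc u" "arc d" "pathstart u = h 0" "pathfinish u = h 1"
    "pathstart d = h 1" "pathfinish d = h 0" "path_image u \<inter> path_image d = {h 0, h 1}"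
    "path_image u \<union> path_image d = path_image ?c"
    by (rule exists_double_arc[of ?c "h 0" "h 1"])
      (use ends h(2) c simple_path_circlepath in auto)
  let ?S = "h ` {0<..<1}"
  \<comment> \<open>Proved for arbitrary names of the two arcs, since either of them may be the one
    containing \<open>?S\<close>.\<close>
  have main: thesis
    if "arc u" "arc d" "{u 0, u 1} = {h 0, h 1}" "{d 0, d 1} = {h 0, h 1}"
      "path_image u \<inter> path_image d = {h 0, h 1}" "path_image u \<union> path_image d = sphere 0 1"
      "?S \<inter> path_image d = {}" for u d
  proof (rule result)
    have "path_image h = ?S \<union> {h 0, h 1}"
      unfolding path_image_def by (force simp: le_less)
    moreover have "?S \<subseteq> path_image u"
      using h(2) that(6,7) \<open>path_image h = _\<close> by blast
    ultimately have "path_image h \<subseteq> path_image u"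
      using that(5) by blast
    then obtain s t where st: "0 \<le> s" "s < t" "t \<le> 1" "{u s, u t} = {h 0, h 1}" "?S = u ` {s<..<t}"
      using subarc_parameters[OF \<open>arc u\<close> h(1)] by blast
    have inj: "inj_on u {0..1}"
      using \<open>arc u\<close> by (simp add: arc_def)
    have "u ` {s, t} = u ` {0, 1}"
      using st that(3) by simp
    then have "{s, t} = {0, 1}"
      using inj_on_image_eq_iff[OF inj, of "{s, t}" "{0, 1}"] st by auto
    then have "s = 0" "t = 1"
      using st by (auto simp: doubleton_eq_iff)
    have "?S = path_image u - {u 0, u 1}"
    proof -
      have "{0<..<1} = {0..1} - {0, 1::real}"
        by auto
      then show ?thesis
        using inj_on_image_set_diff[OF inj, of "{0..1}" "{0, 1}"] st
        by (simp add: \<open>s = 0\<close> \<open>t = 1\<close> path_image_def)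
    qed
    moreover have "{u 0, u 1} \<subseteq> path_image d"
      unfolding that(3) that(5)[symmetric] by simp
    ultimately have "path_image u - ?S \<subseteq> path_image d"
      by (auto simp del: insert_subset)
    then show "path_image d = sphere 0 1 - ?S"
      unfolding that(6)[symmetric] using that(7) by auto
  qed (use that in auto)
  have "connected ?S"
    using h(1) by (intro connected_continuous_image)
      (auto simp: arc_def path_def intro: continuous_on_subset)
  moreover have "?S \<inter> {h 0, h 1} = {}"
    using h(1) by (force simp: arc_def inj_on_def)
  moreover have "?S \<subseteq> path_image u \<union> path_image d"
    using h(2) ud(8) c by (auto simp: path_image_def image_subset_iff)
  ultimately have "path_image u \<inter> ?S = {} \<or> path_image d \<inter> ?S = {}"
    using ud(7) by (intro connected_closedD) (auto simp: ud(1,2) closed_path_image arc_imp_path)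
  then show thesis
    using main[of u d] main[of d u] ud c
    by (auto simp: pathstart_def pathfinish_def insert_commute Int_commute Un_commute)
qed

lemma connected_subset_member_of_disjoint_closed:
  assumes "connected S" "finite \<K>" "pairwise disjnt \<K>" "\<And>K. K \<in> \<K> \<Longrightarrow> closed K"
    "S \<subseteq> \<Union>\<K>" "K \<in> \<K>" "K \<inter> S \<noteq> {}"
  shows "S \<subseteq> K"
proof -
  have "K \<inter> \<Union>(\<K> - {K}) = {}"
    using assms(3,6) by (auto simp: pairwise_def disjnt_def)
  moreover have "closed (\<Union>(\<K> - {K}))"
    using assms(2,4) by (intro closed_Union) auto
  ultimately have "K \<inter> S = {} \<or> \<Union>(\<K> - {K}) \<inter> S = {}"
    using assms by (intro connected_closedD) auto
  then show ?thesis
    using assms by blast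
qed

text \<open>Removing one more arc splits one piece in two. For this the induction needs more than
  parity: each piece is an arc whose corners are exactly its two ends. The untouched circle has no
  ends and forces the exception for \<open>F = {}\<close>.\<close>

lemma circle_minus_open_arcs_aux:
  fixes h :: "'f \<Rightarrow> real \<Rightarrow> complex"
  assumes "finite F" "\<And>f. f \<in> F \<Longrightarrow> arc (h f)" "\<And>f. f \<in> F \<Longrightarrow> path_image (h f) \<subseteq> sphere 0 1"
    "\<And>f f'. f \<in> F \<Longrightarrow> f' \<in> F \<Longrightarrow> f \<noteq> f' \<Longrightarrow> path_image (h f) \<inter> path_image (h f') = {}"
  shows "\<exists>\<K>. finite \<K> \<and> pairwise disjnt \<K> \<and> \<Union>\<K> = sphere 0 1 - (\<Union>f\<in>F. h f ` {0<..<1}) \<and>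
    (\<forall>K\<in>\<K>. if F = {} then K = sphere 0 1
      else \<exists>g. arc g \<and> K = path_image g \<and> K \<inter> (\<Union>f\<in>F. {h f 0, h f 1}) = {g 0, g 1})"
  using assms
proof (induction F)
  case empty
  show ?case
    by (rule exI[of _ "{sphere 0 1}"]) auto
next
  case (insert f F)
  let ?S = "h f ` {0<..<1}"
  let ?cor = "\<lambda>F. \<Union>f\<in>F. {h f 0, h f 1}"
  have "\<exists>\<K>. finite \<K> \<and> pairwise disjnt \<K> \<and> \<Union>\<K> = sphere 0 1 - (\<Union>f\<in>F. h f ` {0<..<1}) \<and>
    (\<forall>K\<in>\<K>. if F = {} then K = sphere 0 1
      else \<exists>g. arc g \<and> K = path_image g \<and> K \<inter> (\<Union>f\<in>F. {h f 0, h f 1}) = {g 0, g 1})"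
    by (rule insert.IH) (use insert.prems in auto)
  then obtain \<K> where fin: "finite \<K>" and dis: "pairwise disjnt \<K>"
    and un: "\<Union>\<K> = sphere 0 1 - (\<Union>f\<in>F. h f ` {0<..<1})"
    and "\<forall>K\<in>\<K>. if F = {} then K = sphere 0 1
      else \<exists>g. arc g \<and> K = path_image g \<and> K \<inter> ?cor F = {g 0, g 1}"
    by (elim exE conjE) (rule that)
  then have pc: "if F = {} then K = sphere 0 1
      else \<exists>g. arc g \<and> K = path_image g \<and> K \<inter> ?cor F = {g 0, g 1}" if "K \<in> \<K>" for K
    using that by (rule_tac bspec)
  have hf: "arc (h f)" "path_image (h f) \<subseteq> sphere 0 1"
    using insert.prems by auto
  have ends: "h f 0 \<in> path_image (h f)" "h f 1 \<in> path_image (h f)" "?S \<subseteq> path_image (h f)"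
    by (auto simp: path_image_def)
  have other: "path_image (h f) \<inter> path_image (h f') = {}" if "f' \<in> F" for f'
    using insert.prems(3)[of f f'] insert.hyps that by auto
  have other': "h f' ` {0<..<1} \<subseteq> path_image (h f')" "h f' 0 \<in> path_image (h f')" "h f' 1 \<in> path_image (h f')"
    for f' by (auto simp: path_image_def)
  show ?case
  proof (cases "F = {}")
    case True
    obtain d where d: "arc d" "path_image d = sphere 0 1 - ?S" "{d 0, d 1} = {h f 0, h f 1}"
      using circle_minus_open_arc[OF hf] .
    have "path_image d \<inter> {h f 0, h f 1} = {d 0, d 1}"
      unfolding d(3)[symmetric] by (auto simp: path_image_def)
    then show ?thesis
      by (intro exI[of _ "{path_image d}"]) (use d True in auto)
  next
    case False
    have "path_image (h f) \<subseteq> \<Union>\<K>"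
      unfolding un using other other' hf(2) by blast
    then obtain K0 where K0: "K0 \<in> \<K>" "h f 0 \<in> K0"
      using ends by blast
    obtain g where g: "arc g" "K0 = path_image g" "K0 \<inter> ?cor F = {g 0, g 1}"
      using pc[OF K0(1)] False by auto
    have clo: "closed K" if "K \<in> \<K>" for K
      using pc[OF that] False by (auto simp: closed_path_image arc_imp_path)
    have sub: "path_image (h f) \<subseteq> K0"
      by (rule connected_subset_member_of_disjoint_closed[OF _ fin dis clo _ K0(1)])
        (use hf(1) \<open>path_image (h f) \<subseteq> \<Union>\<K>\<close> K0 ends in \<open>auto simp: connected_path_image arc_imp_path\<close>)
    obtain s t where st: "0 \<le> s" "s < t" "t \<le> 1" "{g s, g t} = {h f 0, h f 1}" "?S = g ` {s<..<t}"
      using subarc_parameters[OF g(1) hf(1)] sub g(2) by blast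
    have inj: "inj_on g {0..1}"
      using g(1) by (simp add: arc_def)
    have "x \<notin> path_image (h f)" if x: "x \<in> ?cor F" for x
    proof -
      from x obtain f' where "f' \<in> F" "x \<in> {h f' 0, h f' 1}"
        by blast
      then show ?thesis
        using other[of f'] other'(2,3)[of f'] by auto
    qed
    moreover have "g 0 \<in> ?cor F" "g 1 \<in> ?cor F"
      using g(3) by auto
    ultimately have "g 0 \<notin> path_image (h f)" "g 1 \<notin> path_image (h f)"
      by auto
    \<comment> \<open>The ends of \<open>K0\<close> are corners of arcs removed earlier, and these
      are disjoint from the new arc as closed arcs. Hence the new arc is interior to
      \<open>K0\<close> and neither remainder degenerates to a point.\<close>
    then have "g 0 \<notin> {g s, g t}" "g 1 \<notin> {g s, g t}"
      unfolding st(4) using ends by auto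
    then have st': "0 < s" "t < 1"
      using st by (auto simp: le_less)
    define g1 g2 where "g1 = subpath 0 s g" and "g2 = subpath t 1 g"
    have g12: "arc g1" "arc g2" "path_image g1 = g ` {0..s}" "path_image g2 = g ` {t..1}"
      using st st' g(1) by (auto simp: g1_def g2_def path_image_subpath arc_subpath_arc)
    have g12_ends: "g1 0 = g 0" "g1 1 = g s" "g2 0 = g t" "g2 1 = g 1"
      by (auto simp: g1_def g2_def subpath_def)
    have eq_iff: "g x = g y \<longleftrightarrow> x = y" if "x \<in> {0..1}" "y \<in> {0..1}" for x y
      using inj that by (auto dest: inj_onD)
    have K12: "path_image g1 \<union> path_image g2 = K0 - ?S" "path_image g1 \<inter> path_image g2 = {}"
    proof -
      have "{0..s} \<union> {t..1} = {0..1} - {s<..<t}" "{0..s} \<inter> {t..1} = {}"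
        using st by auto
      moreover have "g ` ({0..1} - {s<..<t}) = g ` {0..1} - g ` {s<..<t}"
        by (rule inj_on_image_set_diff[OF inj]) (use st in auto)
      moreover have "g ` ({0..s} \<inter> {t..1}) = g ` {0..s} \<inter> g ` {t..1}"
        by (rule inj_on_image_Int[OF inj]) (use st in auto)
      ultimately show "path_image g1 \<union> path_image g2 = K0 - ?S" "path_image g1 \<inter> path_image g2 = {}"
        unfolding g(2) g12 st(5) by (simp_all add: path_image_def image_Un[symmetric])
    qed
    have cor: "?cor (insert f F) = {g s, g t} \<union> ?cor F"
      using st(4) by auto
    have sub12: "path_image g1 \<subseteq> K0" "path_image g2 \<subseteq> K0"
      using K12 by auto
    have "path_image g1 \<inter> ?cor (insert f F) = path_image g1 \<inter> ({g s, g t} \<union> {g 0, g 1})"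
      using sub12 g(3) unfolding cor by blast
    also have "\<dots> = {g1 0, g1 1}"
      unfolding g12 g12_ends using st(1-3) st' eq_iff by (auto simp: image_iff)
    finally have cor1: "path_image g1 \<inter> ?cor (insert f F) = {g1 0, g1 1}" .
    have "path_image g2 \<inter> ?cor (insert f F) = path_image g2 \<inter> ({g s, g t} \<union> {g 0, g 1})"
      using sub12 g(3) unfolding cor by blast
    also have "\<dots> = {g2 0, g2 1}"
      unfolding g12 g12_ends using st(1-3) st' eq_iff by (auto simp: image_iff)
    finally have cor2: "path_image g2 \<inter> ?cor (insert f F) = {g2 0, g2 1}" .
    have disK0: "K \<inter> K0 = {}" if "K \<in> \<K> - {K0}" for K
      using dis K0(1) that by (auto simp: pairwise_def disjnt_def)
    let ?L = "(\<K> - {K0}) \<union> {path_image g1, path_image g2}"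
    show ?thesis
    proof (intro exI[of _ ?L] conjI ballI)
      show "finite ?L"
        using fin by simp
      have "disjnt K (path_image g1)" "disjnt (path_image g1) K"
        "disjnt K (path_image g2)" "disjnt (path_image g2) K" if "K \<in> \<K> - {K0}" for K
        using disK0[OF that] sub12 by (auto simp: disjnt_def)
      moreover have "disjnt (path_image g1) (path_image g2)" "disjnt (path_image g2) (path_image g1)"
        using K12(2) by (auto simp: disjnt_def)
      moreover have "pairwise disjnt (\<K> - {K0})"
        using dis by (rule pairwise_subset) auto
      ultimately show "pairwise disjnt ?L"
        unfolding pairwise_insert Un_insert_right Un_empty_right by (simp only: insert_iff Diff_iff) metis
      have "\<Union>?L = \<Union>(\<K> - {K0}) \<union> (K0 - ?S)"
        using K12(1) by auto
      also have "\<dots> = \<Union>\<K> - ?S"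
      proof -
        have "\<Union>\<K> = \<Union>(\<K> - {K0}) \<union> K0"
          using K0(1) by auto
        moreover have "\<Union>(\<K> - {K0}) \<inter> ?S = {}"
          using disK0 sub ends(3) by fastforce
        ultimately show ?thesis
          by (simp add: Un_Diff Diff_triv)
      qed
      finally show "\<Union>?L = sphere 0 1 - (\<Union>f\<in>insert f F. h f ` {0<..<1})"
        unfolding un by auto
      fix K assume "K \<in> ?L"
      then consider "K \<in> \<K> - {K0}" | "K = path_image g1" | "K = path_image g2"
        by auto
      then have "\<exists>g. arc g \<and> K = path_image g \<and> K \<inter> ?cor (insert f F) = {g 0, g 1}"
      proof cases
        case 1
        then obtain g' where g': "arc g'" "K = path_image g'" "K \<inter> ?cor F = {g' 0, g' 1}"
          using pc[of K] False by auto
        have "K \<inter> ?cor (insert f F) = K \<inter> ?cor F"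
          using disK0[OF 1] sub ends by auto
        then show ?thesis
          by (intro exI[of _ g'] conjI g'(1,2)) (rule trans[OF _ g'(3)])
      next
        case 2
        show ?thesis
          unfolding 2 by (intro exI[of _ g1] conjI refl g12(1) cor1)
      next
        case 3
        show ?thesis
          unfolding 3 by (intro exI[of _ g2] conjI refl g12(2) cor2)
      qed
      then show "if insert f F = {} then K = sphere 0 1
        else \<exists>g. arc g \<and> K = path_image g \<and> K \<inter> ?cor (insert f F) = {g 0, g 1}"
        by simp
    qed
  qed
qed

text \<open>A whole circle has no corners and an arc has its two ends. Corners are counted by their
  names \<open>(f, j)\<close>, which agrees with counting points because disjoint arcs have distinct
  ends.\<close>

lemma circle_minus_open_arcs:
  fixes h :: "'f \<Rightarrow> real \<Rightarrow> complex"
  assumes "finite F" and arc: "\<And>f. f \<in> F \<Longrightarrow> arc (h f)"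
    and "\<And>f. f \<in> F \<Longrightarrow> path_image (h f) \<subseteq> sphere 0 1"
    and disj: "\<And>f f'. f \<in> F \<Longrightarrow> f' \<in> F \<Longrightarrow> f \<noteq> f' \<Longrightarrow> path_image (h f) \<inter> path_image (h f') = {}"
  shows "\<exists>\<K>. finite \<K> \<and> pairwise disjnt \<K> \<and>
    \<Union>\<K> = sphere 0 1 - (\<Union>f\<in>F. h f ` {0<..<1}) \<and>
    (\<forall>K\<in>\<K>. (closed K \<and> connected K \<and> K \<noteq> {}) \<and>
      even (card {(f, j). f \<in> F \<and> h f (of_bool j) \<in> K}))"
proof -
  let ?cor = "\<Union>f\<in>F. {h f 0, h f 1}"
  have "\<exists>\<K>. finite \<K> \<and> pairwise disjnt \<K> \<and> \<Union>\<K> = sphere 0 1 - (\<Union>f\<in>F. h f ` {0<..<1}) \<and>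
    (\<forall>K\<in>\<K>. if F = {} then K = sphere 0 1
      else \<exists>g. arc g \<and> K = path_image g \<and> K \<inter> ?cor = {g 0, g 1})"
    by (rule circle_minus_open_arcs_aux) (use assms in auto)
  then obtain \<K> where \<K>: "finite \<K>" "pairwise disjnt \<K>" "\<Union>\<K> = sphere 0 1 - (\<Union>f\<in>F. h f ` {0<..<1})"
    and "\<forall>K\<in>\<K>. if F = {} then K = sphere 0 1
      else \<exists>g. arc g \<and> K = path_image g \<and> K \<inter> ?cor = {g 0, g 1}"
    by (elim exE conjE) (rule that)
  then have pc: "if F = {} then K = sphere 0 1
      else \<exists>g. arc g \<and> K = path_image g \<and> K \<inter> ?cor = {g 0, g 1}" if "K \<in> \<K>" for K
    using that by (rule_tac bspec)
  have "(closed K \<and> connected K \<and> K \<noteq> {}) \<and> even (card {(f, j). f \<in> F \<and> h f (of_bool j) \<in> K})"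
    if K: "K \<in> \<K>" for K
  proof
    show "closed K \<and> connected K \<and> K \<noteq> {}"
    proof (cases "F = {}")
      case True
      then show ?thesis
        using pc[OF K] connected_sphere[of "0::complex" 1] by auto
    next
      case False
      then show ?thesis
        using pc[OF K] by (auto simp: closed_path_image connected_path_image arc_imp_path)
    qed
    show "even (card {(f, j). f \<in> F \<and> h f (of_bool j) \<in> K})" (is "even (card ?I)")
    proof (cases "F = {}")
      case False
      obtain g where g: "arc g" "K = path_image g" "K \<inter> ?cor = {g 0, g 1}"
        using pc[OF K] False by auto
      have "(\<lambda>(f, j). h f (of_bool j)) ` ?I = K \<inter> ?cor"
      proof
        show "(\<lambda>(f, j). h f (of_bool j)) ` ?I \<subseteq> K \<inter> ?cor"
          by (auto simp: of_bool_def)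
        show "K \<inter> ?cor \<subseteq> (\<lambda>(f, j). h f (of_bool j)) ` ?I"
        proof
          fix x assume "x \<in> K \<inter> ?cor"
          then obtain f j where "f \<in> F" "x = h f (of_bool j)" "x \<in> K"
            by (metis (no_types, lifting) IntE UN_E insertE of_bool_eq(1) of_bool_eq(2) singletonD)
          then show "x \<in> (\<lambda>(f, j). h f (of_bool j)) ` ?I"
            by (intro image_eqI[of _ _ "(f, j)"]) auto
        qed
      qed
      moreover have "inj_on (\<lambda>(f, j). h f (of_bool j)) ?I"
      proof (rule inj_onI, clarify)
        fix f j f' j'
        assume *: "f \<in> F" "f' \<in> F" "h f (of_bool j) = h f' (of_bool j')"
        have "h f (of_bool j) \<in> path_image (h f)" "h f' (of_bool j') \<in> path_image (h f')"
          by (auto simp: path_image_def)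
        then have "f = f'"
          using disj[of f f'] * by auto
        moreover have "of_bool j = (of_bool j' :: real)"
          using arc[OF *(1)] * calculation by (auto simp: arc_def inj_on_def)
        ultimately show "f = f' \<and> j = j'"
          by (simp add: of_bool_eq_iff)
      qed
      ultimately have "card ?I = card {g 0, g 1}"
        using g(3) by (metis (no_types, lifting) card_image)
      moreover have "g 0 \<noteq> g 1"
        using arc_distinct_ends[OF g(1)] by (simp add: pathstart_def pathfinish_def)
      ultimately show ?thesis
        by simp
    qed simp
  qed
  with \<K> show ?thesis
    by (intro exI[of _ \<K>]) simp
qed

section \<open>The surface of a ribbon graph\<close>

lemma edge_side_eq_iff [simp]: "edge_side i s = edge_side i' s' \<longleftrightarrow> i = i' \<and> s = s'"
  by (auto simp: edge_side_def of_bool_def split: if_splits)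

lemma edge_side_in_square: "s \<in> {0..1} \<Longrightarrow> edge_side i s \<in> cbox 0 (Complex 1 1)"
  by (auto simp: edge_side_def in_cbox_complex_iff)

lemma disc_simps [simp]: "disc (Inl v) = cball 0 1" "disc (Inr e) = cbox 0 (Complex 1 1)"
  by (simp_all add: disc_def)

lemma compact_preimage:
  fixes f :: "real \<Rightarrow> complex"
  assumes "continuous_on {0..1} f" "closed L"
  shows "compact {s \<in> {0..1}. f s \<in> L}"
proof -
  have "closed ({0..1} \<inter> f -` L)"
    using assms by (intro continuous_closed_preimage) auto
  then have "compact ({0..1} \<inter> ({0..1} \<inter> f -` L))"
    by (intro compact_Int_closed) auto
  moreover have "{s \<in> {0..1}. f s \<in> L} = {0..1} \<inter> ({0..1} \<inter> f -` L)"
    by auto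
  ultimately show ?thesis
    by (simp only:)
qed

section \<open>The quotient of the discs and its closed and connected subsets\<close>

locale ribbon =
  fixes G :: "('v, 'e) ribbon_graph"
  assumes ribbon: "is_ribbon_graph G"
begin

lemma finite_verts: "finite (verts G)" and finite_edges: "finite (edges G)"
  using ribbon by (auto simp: is_ribbon_graph_def)

lemma end_vertex_in: "e \<in> edges G \<Longrightarrow> end_vertex G e i \<in> verts G"
  using ribbon by (auto simp: is_ribbon_graph_def)

lemma arc_attach: "e \<in> edges G \<Longrightarrow> arc (attach G e i)"
  using ribbon by (auto simp: is_ribbon_graph_def)

lemma attach_in_sphere: "e \<in> edges G \<Longrightarrow> path_image (attach G e i) \<subseteq> sphere 0 1"
  using ribbon by (auto simp: is_ribbon_graph_def)

lemma attach_norm: "e \<in> edges G \<Longrightarrow> s \<in> {0..1} \<Longrightarrow> attach G e i s \<in> sphere 0 1"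
  using attach_in_sphere[of e i] unfolding path_image_def by blast

lemma attach_disjoint:
  assumes "e \<in> edges G" "e' \<in> edges G" "end_vertex G e i = end_vertex G e' i'"
    "z \<in> path_image (attach G e i)" "z \<in> path_image (attach G e' i')"
  shows "e = e' \<and> i = i'"
  using ribbon assms unfolding is_ribbon_graph_def by blast

lemma attach_eq_iff:
  assumes "e \<in> edges G" "e' \<in> edges G" "end_vertex G e i = end_vertex G e' i'"
    "s \<in> {0..1}" "s' \<in> {0..1}"
  shows "attach G e i s = attach G e' i' s' \<longleftrightarrow> e = e' \<and> i = i' \<and> s = s'"
proof
  assume eq: "attach G e i s = attach G e' i' s'"
  moreover have "attach G e i s \<in> path_image (attach G e i)"
    "attach G e' i' s' \<in> path_image (attach G e' i')"
    unfolding path_image_def using assms(4,5) by blast+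
  ultimately have "e = e' \<and> i = i'"
    using attach_disjoint[OF assms(1-3), of "attach G e i s"] by simp
  then show "e = e' \<and> i = i' \<and> s = s'"
    using eq arc_attach[OF assms(1)] assms(4,5) by (auto simp: arc_def inj_on_def)
qed auto

lemma glued_iff:
  "glued G p q \<longleftrightarrow> (\<exists>e i s. e \<in> edges G \<and> s \<in> {0..1} \<and>
     p = (Inl (end_vertex G e i), attach G e i s) \<and> q = (Inr e, edge_side i s))"
  by (auto simp: glued.simps)

text \<open>\<open>glued\<close> is a matching between vertex points and edge points: a vertex point
  lies on at most one attaching arc, and a point of a side is attached once. So the generated
  equivalence needs at most one step.\<close>

lemma equivclp_glued: "equivclp (glued G) p q \<longleftrightarrow> p = q \<or> glued G p q \<or> glued G q p"
proof
  show "p = q \<or> glued G p q \<or> glued G q p" if "equivclp (glued G) p q"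
    using that unfolding equivclp_def
  proof (induction rule: rtranclp_induct)
    case (step q r)
    have "q = q'" if "glued G p q" "glued G p q'" for p q q'
    proof -
      from that(1) obtain e i s where 1: "e \<in> edges G" "s \<in> {0..1}"
        "p = (Inl (end_vertex G e i), attach G e i s)" "q = (Inr e, edge_side i s)"
        unfolding glued_iff by blast
      from that(2) obtain e' i' s' where 2: "e' \<in> edges G" "s' \<in> {0..1}"
        "p = (Inl (end_vertex G e' i'), attach G e' i' s')" "q' = (Inr e', edge_side i' s')"
        unfolding glued_iff by blast
      show ?thesis
        using attach_eq_iff[OF 1(1) 2(1) _ 1(2) 2(2), of i i'] 1 2 by simp
    qed
    moreover have "p = p'" if "glued G p q" "glued G p' q" for p p' q
      using that unfolding glued_iff by auto
    moreover have "\<not> glued G q r" if "glued G p q" for p q r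
      using that unfolding glued_iff by auto
    ultimately show ?case
      using step unfolding symclp_def by metis
  qed simp
  show "equivclp (glued G) p q" if "p = q \<or> glued G p q \<or> glued G q p"
    using that by (auto intro: equivclp_sym r_into_equivclp)
qed

lemma glue_eq_iff_gen: "glue G p = glue G q \<longleftrightarrow> p = q \<or> glued G p q \<or> glued G q p"
proof -
  have "glue G p = glue G q \<longleftrightarrow> equivclp (glued G) p q"
    unfolding glue_def by (auto intro: equivclp_trans equivclp_sym)
  then show ?thesis
    by (simp add: equivclp_glued)
qed

lemma glue_eq_iff [simp]:
  "glue G (Inl v, z) = glue G (Inl w, z') \<longleftrightarrow> v = w \<and> z = z'"
  "glue G (Inr e, z) = glue G (Inr e', z') \<longleftrightarrow> e = e' \<and> z = z'"
  "glue G (Inl v, z) = glue G (Inr e, z') \<longleftrightarrow>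
    (\<exists>i s. e \<in> edges G \<and> s \<in> {0..1} \<and> v = end_vertex G e i \<and> z = attach G e i s \<and> z' = edge_side i s)"
  "glue G (Inr e, z') = glue G (Inl v, z) \<longleftrightarrow>
    (\<exists>i s. e \<in> edges G \<and> s \<in> {0..1} \<and> v = end_vertex G e i \<and> z = attach G e i s \<and> z' = edge_side i s)"
  by (auto simp: glue_eq_iff_gen glued_iff)

lemma topspace_discs: "topspace (discs_topology G) = (SIGMA d : disc_names G. disc d)"
  by (auto simp: discs_topology_def)

lemma topspace_surface: "topspace (surface G) = glue G ` (SIGMA d : disc_names G. disc d)"
  by (simp add: surface_def topspace_discs)

lemma disc_names_iff [simp]: "Inl v \<in> disc_names G \<longleftrightarrow> v \<in> verts G" "Inr e \<in> disc_names G \<longleftrightarrow> e \<in> edges G"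
  by (auto simp: disc_names_def)

lemma closedin_disc: "closedin (top_of_set (disc d)) L \<longleftrightarrow> closed L \<and> L \<subseteq> disc d"
proof -
  have "closed (disc d)"
    by (simp add: disc_def closed_cbox split: sum.split)
  then show ?thesis
    by (auto simp: closedin_closed_eq)
qed

lemma closedin_surface:
  assumes "S \<subseteq> topspace (surface G)"
    and "\<And>d. d \<in> disc_names G \<Longrightarrow> closed {z \<in> disc d. glue G (d, z) \<in> S}"
  shows "closedin (surface G) S"
proof -
  have "closedin (discs_topology G) {p \<in> topspace (discs_topology G). glue G p \<in> S}"
    unfolding discs_topology_def closedin_sum_topology
    using assms(2) by (auto simp: closedin_disc intro!: back_subst[of closed])
  then show ?thesis
    using quotient_map_quotient_topology[of "discs_topology G" "glue G"] assms(1)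
    unfolding quotient_map_closedin surface_def by blast
qed

text \<open>In a disc of the same kind the preimage is \<open>L\<close> or empty. In a disc of the
  other kind it is the image of a compact set of parameters under at most two arcs or sides, hence
  compact.\<close>

lemma closedin_surface_glue:
  assumes d: "d \<in> disc_names G" and L: "closed L" "L \<subseteq> disc d"
  shows "closedin (surface G) (glue G ` ({d} \<times> L))"
proof (rule closedin_surface)
  show "glue G ` ({d} \<times> L) \<subseteq> topspace (surface G)"
    using assms by (auto simp: topspace_surface intro!: imageI)
  fix d' assume d': "d' \<in> disc_names G"
  have att: "continuous_on {0..1} (attach G e i)" if "e \<in> edges G" for e i
    using arc_attach[OF that] by (simp add: arc_def path_def)
  have side: "continuous_on {0..1} (edge_side i)" for i
    unfolding edge_side_def Complex_eq by (intro continuous_intros)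
  let ?S = "{z \<in> disc d'. glue G (d', z) \<in> glue G ` ({d} \<times> L)}"
  have S: "?S = {z \<in> disc d'. \<exists>z'\<in>L. glue G (d', z) = glue G (d, z')}"
    by auto
  show "closed ?S"
  proof (cases d')
    case (Inl w)
    show ?thesis
    proof (cases d)
      case (Inl v)
      have "?S = (if v = w then L else {})"
        using L(2) by (auto simp: Inl \<open>d' = Inl w\<close>)
      then show ?thesis
        using L by auto
    next
      case (Inr e)
      then have e: "e \<in> edges G"
        using d by simp
      have "?S = (\<Union>i\<in>{i. end_vertex G e i = w}. attach G e i ` {s \<in> {0..1}. edge_side i s \<in> L})"
        (is "_ = ?T")
      proof (intro set_eqI iffI)
        fix x assume "x \<in> ?S"
        then obtain i s where "s \<in> {0..1}" "w = end_vertex G e i" "x = attach G e i s" "edge_side i s \<in> L"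
          unfolding S by (auto simp: Inr \<open>d' = Inl w\<close>)
        then show "x \<in> ?T"
          by blast
      next
        fix x assume "x \<in> ?T"
        then obtain i s where "s \<in> {0..1}" "w = end_vertex G e i" "x = attach G e i s" "edge_side i s \<in> L"
          by blast
        then show "x \<in> ?S"
          unfolding S using e attach_norm[OF e, of s i] by (auto simp: Inr \<open>d' = Inl w\<close>)
      qed
      moreover have "compact (\<Union>i\<in>{i. end_vertex G e i = w}. attach G e i ` {s \<in> {0..1}. edge_side i s \<in> L})"
        using L(1) side e
        by (intro compact_UN compact_continuous_image compact_preimage continuous_on_subset[OF att]) auto
      ultimately show ?thesis
        by (simp only: compact_imp_closed)
    qed
  next
    case (Inr e)
    then have e: "e \<in> edges G"
      using d' by simp
    show ?thesis
    proof (cases d)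
      case (Inl v)
      have "?S = (\<Union>i\<in>{i. end_vertex G e i = v}. edge_side i ` {s \<in> {0..1}. attach G e i s \<in> L})"
        (is "_ = ?T")
      proof (intro set_eqI iffI)
        fix x assume "x \<in> ?S"
        then obtain i s where "s \<in> {0..1}" "v = end_vertex G e i" "x = edge_side i s" "attach G e i s \<in> L"
          unfolding S by (auto simp: Inl \<open>d' = Inr e\<close>)
        then show "x \<in> ?T"
          by blast
      next
        fix x assume "x \<in> ?T"
        then obtain i s where "s \<in> {0..1}" "v = end_vertex G e i" "x = edge_side i s" "attach G e i s \<in> L"
          by blast
        then show "x \<in> ?S"
          unfolding S using e edge_side_in_square[of s i] by (auto simp: Inl \<open>d' = Inr e\<close>)
      qed
      moreover have "compact (\<Union>i\<in>{i. end_vertex G e i = v}. edge_side i ` {s \<in> {0..1}. attach G e i s \<in> L})"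
        using L(1) att e
        by (intro compact_UN compact_continuous_image compact_preimage continuous_on_subset[OF side]) auto
      ultimately show ?thesis
        by (simp only: compact_imp_closed)
    next
      case (Inr e')
      have "?S = (if e = e' then L else {})"
        using L(2) by (auto simp: Inr \<open>d' = Inr e\<close>)
      then show ?thesis
        using L by auto
    qed
  qed
qed

lemma connectedin_surface_glue:
  assumes "d \<in> disc_names G" "connected L" "L \<subseteq> disc d"
  shows "connectedin (surface G) (glue G ` ({d} \<times> L))"
proof -
  have "continuous_map (top_of_set (disc d)) (discs_topology G) (Pair d)"
    unfolding discs_topology_def using assms(1) by (rule continuous_map_component_injection)
  moreover have "continuous_map (discs_topology G) (surface G) (glue G)"
    unfolding surface_def by (rule quotient_imp_continuous_map) (rule quotient_map_quotient_topology)
  ultimately have "continuous_map (top_of_set (disc d)) (surface G) (glue G \<circ> Pair d)"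
    by (rule continuous_map_compose)
  moreover have "connectedin (top_of_set (disc d)) L"
    using assms by (simp add: connectedin_subtopology)
  ultimately have "connectedin (surface G) ((glue G \<circ> Pair d) ` L)"
    by (rule connectedin_continuous_map_image)
  moreover have "(glue G \<circ> Pair d) ` L = glue G ` ({d} \<times> L)"
    by auto
  ultimately show ?thesis
    by simp
qed

end

section \<open>Connected components of a ribbon graph\<close>

lemma connectedin_Un_UN:
  assumes "connectedin X B" "\<And>a. a \<in> A \<Longrightarrow> connectedin X (S a)" "\<And>a. a \<in> A \<Longrightarrow> S a \<inter> B \<noteq> {}"
    "B \<noteq> {}"
  shows "connectedin X (B \<union> (\<Union>a\<in>A. S a))"
proof -
  have "connectedin X (\<Union>(insert B ((\<lambda>a. S a \<union> B) ` A)))"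
  proof (rule connectedin_Union)
    show "connectedin X T" if "T \<in> insert B ((\<lambda>a. S a \<union> B) ` A)" for T
      using that assms by (auto intro!: connectedin_Un)
    show "\<Inter> (insert B ((\<lambda>a. S a \<union> B) ` A)) \<noteq> {}"
      using assms(4) by auto
  qed
  moreover have "\<Union>(insert B ((\<lambda>a. S a \<union> B) ` A)) = B \<union> (\<Union>a\<in>A. S a)"
    by auto
  ultimately show ?thesis
    by simp
qed

definition edge_rel :: "('v, 'e) ribbon_graph \<Rightarrow> 'v rel" where
  "edge_rel G = {(end_vertex G e i, end_vertex G e i') | e i i'. e \<in> edges G}"

lemma sym_edge_rel: "sym (edge_rel G)"
  by (auto simp: edge_rel_def sym_def)

context ribbon
begin

text \<open>The surface is covered by stars, each a vertex disc with all incident edge discs. Two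
  stars meet exactly if they coincide or share an edge disc, so the vertices alone index the
  cover.\<close>

lemma num_components_eq: "num_components G = card (verts G // (edge_rel G)\<^sup>*)"
proof -
  define B where "B v = glue G ` ({Inl v} \<times> cball 0 1)" for v
  define D where "D e = glue G ` ({Inr e} \<times> cbox 0 (Complex 1 1))" for e
  define I where "I v = {(e, i). e \<in> edges G \<and> end_vertex G e i = v}" for v
  define C where "C v = B v \<union> (\<Union>(e, i)\<in>I v. D e)" for v
  have finI: "finite (I v)" for v
    by (rule finite_subset[of _ "edges G \<times> UNIV"]) (use finite_edges in \<open>auto simp: I_def\<close>)
  have B_sub: "B v \<subseteq> C v" and D_sub: "(e, i) \<in> I v \<Longrightarrow> D e \<subseteq> C v" for v e i
    by (auto simp: C_def)
  have clo: "closedin (surface G) (B v)" and con: "connectedin (surface G) (B v)" if "v \<in> verts G" for v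
    unfolding B_def using that
    by (auto intro!: closedin_surface_glue connectedin_surface_glue)
  have cloD: "closedin (surface G) (D e)" and conD: "connectedin (surface G) (D e)" if "e \<in> edges G" for e
    unfolding D_def using that convex_connected[OF convex_box(1)]
    by (auto intro!: closedin_surface_glue connectedin_surface_glue)
  have BB: "v = w" if "B v \<inter> B w \<noteq> {}" for v w
    using that by (auto simp: B_def)
  have BD: "\<exists>i. e \<in> edges G \<and> v = end_vertex G e i" if "B v \<inter> D e \<noteq> {}" for v e
    using that by (auto simp: B_def D_def)
  have DD: "e = e'" if "D e \<inter> D e' \<noteq> {}" for e e'
    using that by (auto simp: D_def)
  interpret closed_connected_cover "surface G" "verts G" C "edge_rel G"
  proof
    show "finite (verts G)"
      by (rule finite_verts)
    show "closedin (surface G) (C v)" if "v \<in> verts G" for v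
      unfolding C_def using clo[OF that] cloD finI
      by (intro closedin_Un closedin_Union) (auto simp: I_def)
    show "C v \<noteq> {}" for v
      by (auto simp: C_def B_def)
    show "connectedin (surface G) (C v)" if v: "v \<in> verts G" for v
      unfolding C_def
    proof (rule connectedin_Un_UN)
      show "(case a of (e, i) \<Rightarrow> D e) \<inter> B v \<noteq> {}" if "a \<in> I v" for a
      proof -
        from that obtain e i where a: "a = (e, i)" "e \<in> edges G" "end_vertex G e i = v"
          by (auto simp: I_def)
        have "glue G (Inl v, attach G e i 0) \<in> B v"
          using attach_norm[OF a(2), of 0 i] by (auto simp: B_def)
        moreover have "glue G (Inr e, edge_side i 0) \<in> D e"
          using edge_side_in_square[of 0 i] by (auto simp: D_def)
        moreover have "glue G (Inl v, attach G e i 0) = glue G (Inr e, edge_side i 0)"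
          using a by auto
        ultimately show ?thesis
          using a(1) by auto
      qed
    qed (use con[OF v] conD in \<open>auto simp: I_def B_def\<close>)
    show "topspace (surface G) = (\<Union>v\<in>verts G. C v)"
    proof
      show "topspace (surface G) \<subseteq> (\<Union>v\<in>verts G. C v)"
      proof
        fix x assume "x \<in> topspace (surface G)"
        then obtain d z where dz: "d \<in> disc_names G" "z \<in> disc d" "x = glue G (d, z)"
          by (auto simp: topspace_surface)
        show "x \<in> (\<Union>v\<in>verts G. C v)"
        proof (cases d)
          case (Inl v)
          then have "v \<in> verts G" "x \<in> B v"
            using dz by (auto simp: B_def)
          then show ?thesis
            using B_sub by auto
        next
          case (Inr e)
          then have "e \<in> edges G" "x \<in> D e"
            using dz by (auto simp: D_def)
          then show ?thesis
            using D_sub[of e True "end_vertex G e True"] end_vertex_in[of e True]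
            by (auto simp: I_def)
        qed
      qed
      show "(\<Union>v\<in>verts G. C v) \<subseteq> topspace (surface G)"
        using clo cloD by (auto simp: C_def I_def dest!: closedin_subset)
    qed
    show "edge_rel G \<subseteq> verts G \<times> verts G"
      using end_vertex_in by (auto simp: edge_rel_def)
    show "C v \<inter> C w \<noteq> {} \<longleftrightarrow> v = w \<or> (v, w) \<in> edge_rel G" for v w
    proof
      assume "C v \<inter> C w \<noteq> {}"
      then obtain x where "x \<in> C v" "x \<in> C w"
        by auto
      moreover have "x \<in> C u \<longleftrightarrow> x \<in> B u \<or> (\<exists>e i. (e, i) \<in> I u \<and> x \<in> D e)" for u
        by (auto simp: C_def)
      ultimately consider "x \<in> B v" "x \<in> B w"
        | e i where "(e, i) \<in> I w" "x \<in> B v" "x \<in> D e"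
        | e i where "(e, i) \<in> I v" "x \<in> B w" "x \<in> D e"
        | e i e' i' where "(e, i) \<in> I v" "(e', i') \<in> I w" "x \<in> D e" "x \<in> D e'"
        by metis
      then show "v = w \<or> (v, w) \<in> edge_rel G"
      proof cases
        case 1
        then show ?thesis
          using BB by auto
      next
        case 2
        then show ?thesis
          using BD[of v e] by (auto simp: edge_rel_def I_def)
      next
        case 3
        then show ?thesis
          using BD[of w e] by (auto simp: edge_rel_def I_def)
      next
        case 4
        then show ?thesis
          using DD[of e e'] by (auto simp: edge_rel_def I_def)
      qed
    next
      assume "v = w \<or> (v, w) \<in> edge_rel G"
      then show "C v \<inter> C w \<noteq> {}"
      proof
        assume "(v, w) \<in> edge_rel G"
        then obtain e i i' where "(e, i) \<in> I v" "(e, i') \<in> I w"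
          by (auto simp: edge_rel_def I_def)
        then have "D e \<subseteq> C v \<inter> C w"
          using D_sub by blast
        moreover have "D e \<noteq> {}"
          using edge_side_in_square[of 0 True] by (auto simp: D_def)
        ultimately show ?thesis
          by auto
      qed (auto simp: C_def B_def)
    qed
  qed
  show ?thesis
    unfolding num_components_def by (rule card_components)
qed

end

section \<open>Boundary components\<close>

definition corner_vertex :: "('v, 'e) ribbon_graph \<Rightarrow> 'e corner \<Rightarrow> 'v" where
  "corner_vertex G c = (case c of (e, i, j) \<Rightarrow> end_vertex G e i)"

definition corner_point :: "('v, 'e) ribbon_graph \<Rightarrow> 'e corner \<Rightarrow> complex" where
  "corner_point G c = (case c of (e, i, j) \<Rightarrow> attach G e i (of_bool j))"

definition ends :: "('v, 'e) ribbon_graph \<Rightarrow> 'v \<Rightarrow> ('e \<times> bool) set" where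
  "ends G v = {(e, i). e \<in> edges G \<and> end_vertex G e i = v}"

lemma corner_simps [simp]:
  "corner_vertex G (e, i, j) = end_vertex G e i"
  "corner_point G (e, i, j) = attach G e i (of_bool j)"
  "(e, i) \<in> ends G v \<longleftrightarrow> e \<in> edges G \<and> end_vertex G e i = v"
  by (simp_all add: corner_vertex_def corner_point_def ends_def)

text \<open>The circle lemma gives mere existence, so a choice of pieces is fixed here. The arcs of
  every edge of \<open>G\<close> are removed, whatever its state, and corners survive because only
  open arcs are removed.\<close>

locale ribbon_pieces = ribbon G for G :: "('v, 'e) ribbon_graph" +
  fixes pieces :: "'v \<Rightarrow> complex set set"
  assumes finite_pieces: "\<And>v. v \<in> verts G \<Longrightarrow> finite (pieces v)"
    and disjoint_pieces: "\<And>v. v \<in> verts G \<Longrightarrow> pairwise disjnt (pieces v)"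
    and Union_pieces: "\<And>v. v \<in> verts G \<Longrightarrow>
      \<Union>(pieces v) = sphere 0 1 - (\<Union>f\<in>ends G v. case_prod (attach G) f ` {0<..<1})"
    and piece: "\<And>v K. v \<in> verts G \<Longrightarrow> K \<in> pieces v \<Longrightarrow> closed K \<and> connected K \<and> K \<noteq> {}"
    and even_corners: "\<And>v K. v \<in> verts G \<Longrightarrow> K \<in> pieces v \<Longrightarrow>
      even (card {(f, j). f \<in> ends G v \<and> case_prod (attach G) f (of_bool j) \<in> K})"

context ribbon
begin

lemma exists_pieces: "\<exists>pieces. ribbon_pieces G pieces"
proof -
  have "\<forall>v\<in>verts G. \<exists>\<K>. finite \<K> \<and> pairwise disjnt \<K> \<and>
      \<Union>\<K> = sphere 0 1 - (\<Union>f\<in>ends G v. case_prod (attach G) f ` {0<..<1}) \<and>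
      (\<forall>K\<in>\<K>. (closed K \<and> connected K \<and> K \<noteq> {}) \<and>
        even (card {(f, j). f \<in> ends G v \<and> case_prod (attach G) f (of_bool j) \<in> K}))"
  proof
    fix v assume "v \<in> verts G"
    have fin: "finite (ends G v)"
      by (rule finite_subset[of _ "edges G \<times> UNIV"]) (use finite_edges in \<open>auto simp: ends_def\<close>)
    have arc: "arc (case_prod (attach G) f)" if "f \<in> ends G v" for f
      using that arc_attach by (cases f) auto
    have sub: "path_image (case_prod (attach G) f) \<subseteq> sphere 0 1" if "f \<in> ends G v" for f
      using that attach_in_sphere by (cases f) (simp del: mem_sphere_0)
    have disj: "path_image (case_prod (attach G) f) \<inter> path_image (case_prod (attach G) f') = {}"
      if "f \<in> ends G v" "f' \<in> ends G v" "f \<noteq> f'" for f f'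
    proof -
      obtain e i e' i' where "f = (e, i)" "f' = (e', i')"
        by (cases f; cases f')
      then show ?thesis
        using that attach_disjoint[of e e' i i'] by auto
    qed
    show "\<exists>\<K>. finite \<K> \<and> pairwise disjnt \<K> \<and>
      \<Union>\<K> = sphere 0 1 - (\<Union>f\<in>ends G v. case_prod (attach G) f ` {0<..<1}) \<and>
      (\<forall>K\<in>\<K>. (closed K \<and> connected K \<and> K \<noteq> {}) \<and>
        even (card {(f, j). f \<in> ends G v \<and> case_prod (attach G) f (of_bool j) \<in> K}))"
      by (rule circle_minus_open_arcs) (fact fin arc sub disj)+
  qed
  then obtain pieces where *: "\<forall>v\<in>verts G. finite (pieces v) \<and> pairwise disjnt (pieces v) \<and>
      \<Union>(pieces v) = sphere 0 1 - (\<Union>f\<in>ends G v. case_prod (attach G) f ` {0<..<1}) \<and>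
      (\<forall>K\<in>pieces v. (closed K \<and> connected K \<and> K \<noteq> {}) \<and>
        even (card {(f, j). f \<in> ends G v \<and> case_prod (attach G) f (of_bool j) \<in> K}))"
    by (rule bchoice[THEN exE])
  have "ribbon_pieces G pieces"
    by unfold_locales (use * in simp_all)
  then show ?thesis
    by (intro exI[of _ pieces])
qed

lemma open_arc_subset: "attach G e i ` {0<..<1} \<subseteq> path_image (attach G e i)"
  by (auto simp: path_image_def)

lemma corner_point_in: "attach G e i (of_bool j) \<in> path_image (attach G e i)"
  unfolding path_image_def by (rule imageI) auto

lemma corner_point_not_in_open_arc:
  assumes "fst c \<in> edges G" "f \<in> ends G (corner_vertex G c)"
  shows "corner_point G c \<notin> case_prod (attach G) f ` {0<..<1}"
proof
  assume *: "corner_point G c \<in> case_prod (attach G) f ` {0<..<1}"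
  obtain e i j e' i' where c: "c = (e, i, j)" and f: "f = (e', i')"
    by (cases c; cases f) auto
  from * c f obtain s where s: "s \<in> {0<..<1}" "attach G e i (of_bool j) = attach G e' i' s"
    by auto
  then have "of_bool j = s"
    using attach_eq_iff[of e e' i i' "of_bool j" s] assms c f by auto
  then show False
    using s(1) by (cases j) auto
qed

end

context ribbon_pieces
begin

abbreviation "Pieces \<equiv> Sigma (verts G) pieces"

text \<open>The vertex is part of a piece because all vertex discs are the same subset of the plane,
  and one set may be a piece at several vertices. A corner lies in exactly one piece of its
  vertex.\<close>

definition piece_of :: "'e corner \<Rightarrow> 'v \<times> complex set" where
  "piece_of c = (corner_vertex G c, THE K. K \<in> pieces (corner_vertex G c) \<and> corner_point G c \<in> K)"

lemma piece_unique:
  "v \<in> verts G \<Longrightarrow> K \<in> pieces v \<Longrightarrow> K' \<in> pieces v \<Longrightarrow> z \<in> K \<Longrightarrow> z \<in> K' \<Longrightarrow> K = K'"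
  using disjoint_pieces[of v] by (auto simp: pairwise_def disjnt_def)

lemma corner_vertex_in: "fst c \<in> edges G \<Longrightarrow> corner_vertex G c \<in> verts G"
  using end_vertex_in by (cases c) auto

lemma piece_of_eq_iff:
  assumes "fst c \<in> edges G"
  shows "piece_of c = (v, K) \<longleftrightarrow> v = corner_vertex G c \<and> K \<in> pieces v \<and> corner_point G c \<in> K"
proof -
  let ?v = "corner_vertex G c"
  have v: "?v \<in> verts G"
    using assms by (rule corner_vertex_in)
  have "corner_point G c \<in> sphere 0 1"
    using assms attach_norm[of "fst c" "of_bool (snd (snd c))" "fst (snd c)"]
    by (cases c) auto
  then have "corner_point G c \<in> \<Union>(pieces ?v)"
    unfolding Union_pieces[OF v] using corner_point_not_in_open_arc[OF assms] by auto
  then obtain L where L: "L \<in> pieces ?v" "corner_point G c \<in> L"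
    by auto
  have "(THE K. K \<in> pieces ?v \<and> corner_point G c \<in> K) = K"
    if "K \<in> pieces ?v" "corner_point G c \<in> K" for K
    by (rule the_equality) (use that piece_unique[OF v] in auto)
  then show ?thesis
    unfolding piece_of_def using L by auto
qed

lemma piece_of_in:
  assumes "fst c \<in> edges G"
  shows "piece_of c \<in> Pieces"
proof -
  obtain v K where "piece_of c = (v, K)"
    by (cases "piece_of c")
  then show ?thesis
    using piece_of_eq_iff[OF assms, of v K] corner_vertex_in[OF assms] by auto
qed

sublocale strand_system "edges G" Pieces piece_of
proof
  show "finite Pieces"
    using finite_verts finite_pieces by auto
  show "even (card {c \<in> edges G \<times> UNIV. piece_of c = p})" if p: "p \<in> Pieces" for p
  proof -
    obtain v K where vK: "p = (v, K)" "v \<in> verts G" "K \<in> pieces v"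
      using p by auto
    let ?I = "{(f, j). f \<in> ends G v \<and> case_prod (attach G) f (of_bool j) \<in> K}"
    have "{c \<in> edges G \<times> UNIV. piece_of c = p} = (\<lambda>((e, i), j). (e, i, j)) ` ?I"
    proof (intro set_eqI iffI)
      fix c assume c: "c \<in> {c \<in> edges G \<times> UNIV. piece_of c = p}"
      obtain e i j where eij: "c = (e, i, j)"
        by (cases c)
      have "((e, i), j) \<in> ?I"
        using c piece_of_eq_iff[of c v K] vK(1) by (simp add: eij)
      then show "c \<in> (\<lambda>((e, i), j). (e, i, j)) ` ?I"
        by (rule rev_image_eqI) (simp add: eij)
    next
      fix c assume "c \<in> (\<lambda>((e, i), j). (e, i, j)) ` ?I"
      then show "c \<in> {c \<in> edges G \<times> UNIV. piece_of c = p}"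
        using piece_of_eq_iff[of c v K] vK by auto
    qed
    moreover have "inj_on (\<lambda>((e, i), j). (e, i, j)) ?I"
      by (auto simp: inj_on_def)
    ultimately show ?thesis
      using even_corners[OF vK(2,3)] by (simp add: card_image)
  qed
qed (use finite_edges piece_of_in in auto)

end

section \<open>Strands of a state and their intersections\<close>

definition horizontal_side :: "bool \<Rightarrow> complex set" where
  "horizontal_side h = (\<lambda>u. Complex u (of_bool h)) ` {0..1}"

lemma horizontal_side:
  "closed (horizontal_side h)" "connected (horizontal_side h)"
  "horizontal_side h \<subseteq> cbox 0 (Complex 1 1)"
proof -
  have "continuous_on {0..1} (\<lambda>u. Complex u (of_bool h))"
    unfolding Complex_eq by (intro continuous_intros)
  then show "closed (horizontal_side h)" "connected (horizontal_side h)"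
    unfolding horizontal_side_def
    by (auto intro!: compact_imp_closed compact_continuous_image connected_continuous_image)
  show "horizontal_side h \<subseteq> cbox 0 (Complex 1 1)"
    by (auto simp: horizontal_side_def in_cbox_complex_iff)
qed

locale ribbon_state = ribbon_pieces G pieces
  for G :: "('v, 'e) ribbon_graph" and pieces :: "'v \<Rightarrow> complex set set" +
  fixes Y Z :: "'e set"
begin

definition H :: "('v, 'e) ribbon_graph" where
  "H = delete_edges (partial_petrial G Z) Y"

text \<open>At a deleted edge the boundary runs along the attaching arc to the other corner of the
  same end. At a kept edge it follows a horizontal side to the other end, and the corner index
  switches if one arc is reversed.\<close>

definition \<tau> :: "'e \<Rightarrow> bool \<times> bool" where
  "\<tau> e = (if e \<in> Y then (False, True) else if e \<in> Z then (True, True) else (True, False))"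

sublocale H: ribbon H
  by unfold_locales (simp add: H_def is_ribbon_graph_delete_edges is_ribbon_graph_partial_petrial ribbon)

lemma H_simps [simp]:
  "verts H = verts G" "edges H = edges G - Y" "end_vertex H = end_vertex G"
  "attach H e i = (if e \<in> Z \<and> i then reversepath (attach G e i) else attach G e i)"
  by (simp_all add: H_def delete_edges_def partial_petrial_def)

lemma attach_H:
  "path_image (attach H e i) = path_image (attach G e i)"
  "attach H e i ` {0<..<1} = attach G e i ` {0<..<1}"
  "attach H e i (of_bool h) = attach G e i (of_bool (h \<noteq> (e \<in> Z \<and> i)))"
proof -
  show "path_image (attach H e i) = path_image (attach G e i)"
    by simp
  have "(\<lambda>s. 1 - s) ` {0<..<1} = {0<..<1::real}"
    by (auto intro!: image_eqI[of _ _ "1 - _"])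
  then have "(\<lambda>s. attach G e i (1 - s)) ` {0<..<1} = attach G e i ` {0<..<1}"
    by (metis image_image)
  then show "attach H e i ` {0<..<1} = attach G e i ` {0<..<1}"
    by (cases "e \<in> Z \<and> i") (auto simp: reversepath_def)
  show "attach H e i (of_bool h) = attach G e i (of_bool (h \<noteq> (e \<in> Z \<and> i)))"
    by (cases h) (auto simp: reversepath_def)
qed

declare H_simps(4) [simp del]

text \<open>Corners are named after \<open>G\<close>. In \<open>H\<close> the end
  \<open>True\<close> of an edge in \<open>Z\<close> is attached by the reversed arc, so its two
  corners exchange heights on the side of the square.\<close>

definition height :: "'e corner \<Rightarrow> bool" where
  "height c = (case c of (e, i, j) \<Rightarrow> j \<noteq> (e \<in> Z \<and> i))"

lemma attach_H_height: "attach H e i (of_bool (height (e, i, j))) = attach G e i (of_bool j)"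
  unfolding attach_H(3) by (rule arg_cong[of _ _ "\<lambda>b. attach G e i (of_bool b)"]) (auto simp: height_def)

lemma height_partner: "fst c \<notin> Y \<Longrightarrow> height (partner \<tau> c) = height c"
  by (cases c) (auto simp: height_def \<tau>_def)

lemma height_eq_imp:
  "e \<notin> Y \<Longrightarrow> height (e, i, j) = height (e, i', j') \<Longrightarrow>
    (e, i', j') = (e, i, j) \<or> (e, i', j') = partner \<tau> (e, i, j)"
  by (auto simp: height_def \<tau>_def)

text \<open>A deleted edge has no disc in \<open>H\<close>, so its strands are the closed attaching
  arcs themselves. Either corner of a strand yields the same set.\<close>

definition strand :: "'e corner \<Rightarrow> (('v + 'e) \<times> complex) set set" where
  "strand c = (case c of (e, i, j) \<Rightarrow>
     if e \<in> Y then glue H ` ({Inl (end_vertex G e i)} \<times> path_image (attach G e i))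
     else glue H ` ({Inr e} \<times> horizontal_side (height c)))"

text \<open>Each strand is included at the pieces of both its corners. This makes adjacent sets
  overlap and keeps every set closed and connected.\<close>

definition cover_set :: "'v \<times> complex set \<Rightarrow> (('v + 'e) \<times> complex) set set" where
  "cover_set p = glue H ` ({Inl (fst p)} \<times> snd p) \<union> (\<Union>c\<in>{c. fst c \<in> edges G \<and> piece_of c = p}. strand c)"

lemma strand_partner: "strand (partner \<tau> c) = strand c"
proof -
  obtain e i j where c: "c = (e, i, j)"
    by (cases c)
  show ?thesis
  proof (cases "e \<in> Y")
    case False
    then show ?thesis
      using height_partner[of c] by (auto simp: strand_def c)
  qed (auto simp: strand_def \<tau>_def c)
qed

lemma strand_nonempty: "strand c \<noteq> {}"
  by (auto simp: strand_def horizontal_side_def split: prod.split)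

lemma strand_closed_connected:
  assumes "fst c \<in> edges G"
  shows "closedin (surface H) (strand c)" "connectedin (surface H) (strand c)"
proof -
  obtain e i j where c: "c = (e, i, j)"
    by (cases c)
  have "path_image (attach G e i) \<subseteq> cball 0 1"
    using attach_in_sphere[of e i] assms c by (auto simp: subset_iff)
  moreover have "arc (attach G e i)"
    using assms c arc_attach by simp
  ultimately show "closedin (surface H) (strand c)" "connectedin (surface H) (strand c)"
    using assms horizontal_side end_vertex_in[of e i] unfolding strand_def c
    by (auto intro!: H.closedin_surface_glue H.connectedin_surface_glue
        intro: horizontal_side(3)[THEN subsetD]
        simp: closed_path_image connected_path_image arc_imp_path)
qed

lemma corner_in_strand:
  assumes "fst c \<in> edges G"
  shows "glue H (Inl (corner_vertex G c), corner_point G c) \<in> strand c"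
proof -
  obtain e i j where c: "c = (e, i, j)"
    by (cases c)
  show ?thesis
  proof (cases "e \<in> Y")
    case True
    then show ?thesis
      using corner_point_in by (auto simp: c strand_def intro!: imageI)
  next
    case False
    define h where "h = height c"
    have "glue H (Inl (end_vertex G e i), attach G e i (of_bool j)) = glue H (Inr e, edge_side i (of_bool h))"
      unfolding H.glue_eq_iff using False assms c attach_H_height[of e i j]
      by (intro exI[of _ i] exI[of _ "of_bool h"]) (auto simp: h_def)
    moreover have "edge_side i (of_bool h) \<in> horizontal_side h"
      by (auto simp: horizontal_side_def edge_side_def intro!: imageI)
    then have "glue H (Inr e, edge_side i (of_bool h)) \<in> glue H ` ({Inr e} \<times> horizontal_side h)"
      by (intro imageI SigmaI) auto
    moreover have "strand c = glue H ` ({Inr e} \<times> horizontal_side h)"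
      using False by (simp add: c strand_def h_def)
    ultimately show ?thesis
      by (simp only: c corner_simps)
  qed
qed

text \<open>Away from the open attaching arcs, a strand touches the vertex circles only at its two
  corners. Hence a piece meets only strands with a corner on it.\<close>

lemma vertex_point_in_strand:
  assumes "fst c \<in> edges G" "v \<in> verts G"
    and "z \<notin> (\<Union>f\<in>ends G v. case_prod (attach G) f ` {0<..<1})"
    and "glue H (Inl v, z) \<in> strand c"
  obtains c' where "c' = c \<or> c' = partner \<tau> c" "v = corner_vertex G c'" "z = corner_point G c'"
proof -
  obtain e i j where c: "c = (e, i, j)"
    by (cases c)
  have e: "e \<in> edges G"
    using assms(1) c by simp
  show thesis
  proof (cases "e \<in> Y")
    case True
    then have "v = end_vertex G e i" "z \<in> path_image (attach G e i)"
      using assms(4) by (auto simp: c strand_def)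
    then obtain s where s: "s \<in> {0..1}" "z = attach G e i s"
      by (auto simp: path_image_def)
    have "s \<notin> {0<..<1}"
    proof
      assume "s \<in> {0<..<1}"
      then have "z \<in> case_prod (attach G) (e, i) ` {0<..<1}"
        using s by simp
      then show False
        using assms(3) e \<open>v = _\<close> by (metis UN_I corner_simps(3))
    qed
    then have "s = of_bool (s = 1)"
      using s(1) by auto
    then obtain j' where "s = of_bool j'" ..
    then have "z = corner_point G (e, i, j')"
      using s by simp
    moreover have "(e, i, j') = c \<or> (e, i, j') = partner \<tau> c"
      using True by (auto simp: c \<tau>_def)
    ultimately show thesis
      using that \<open>v = _\<close> by auto
  next
    case False
    define h where "h = height c"
    have "strand c = glue H ` ({Inr e} \<times> horizontal_side h)"
      using False by (simp add: c strand_def h_def)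
    then obtain w where "w \<in> horizontal_side h" "glue H (Inl v, z) = glue H (Inr e, w)"
      using assms(4) by (simp only:) blast
    then obtain u where "glue H (Inl v, z) = glue H (Inr e, Complex u (of_bool h))"
      unfolding horizontal_side_def by blast
    then obtain i' s where *: "v = end_vertex G e i'" "z = attach H e i' s" "Complex u (of_bool h) = edge_side i' s"
      unfolding H.glue_eq_iff by auto
    then have "s = of_bool h"
      by (simp add: edge_side_def)
    define j' where "j' = (h \<noteq> (e \<in> Z \<and> i'))"
    have "height (e, i', j') = h"
      by (auto simp: height_def j'_def)
    then have "z = corner_point G (e, i', j')"
      using * attach_H_height[of e i' j'] \<open>s = _\<close> by simp
    moreover have "(e, i', j') = c \<or> (e, i', j') = partner \<tau> c"
      unfolding c by (rule height_eq_imp[OF False]) (simp add: \<open>height _ = h\<close>, simp add: h_def c)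
    ultimately show thesis
      using that * by auto
  qed
qed

text \<open>Attaching arcs are disjoint including their ends, and the two horizontal sides of a
  square are disjoint, so distinct strands have no point in common.\<close>

lemma strands_meet:
  assumes "fst c \<in> edges G" "fst c' \<in> edges G" "strand c \<inter> strand c' \<noteq> {}"
  shows "c' = c \<or> c' = partner \<tau> c"
proof -
  obtain e i j where c: "c = (e, i, j)"
    by (cases c)
  obtain e' i' j' where c': "c' = (e', i', j')"
    by (cases c')
  have e: "e \<in> edges G" "e' \<in> edges G"
    using assms c c' by auto
  \<comment> \<open>A common point of a deleted arc and a kept edge disc would lie on the attaching
    arcs of two different edges.\<close>
  have mixed: False
    if "glue H (Inl (end_vertex G f k), z) = glue H (Inr f', w)" "z \<in> path_image (attach G f k)"
      "f \<in> Y" "f \<in> edges G" for f k f' z w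
  proof -
    from that(1) obtain l s where
      "f' \<in> edges G" "f' \<notin> Y" "s \<in> {0..1}" "end_vertex G f k = end_vertex G f' l" "z = attach H f' l s"
      unfolding H.glue_eq_iff by auto
    moreover from this have "z \<in> path_image (attach G f' l)"
      by (simp only: attach_H(1)[symmetric]) (auto simp: path_image_def)
    ultimately show False
      using attach_disjoint[of f f' k l z] that by auto
  qed
  obtain x where x: "x \<in> strand c" "x \<in> strand c'"
    using assms(3) by auto
  consider "e \<in> Y" "e' \<in> Y" | "e \<in> Y" "e' \<notin> Y" | "e \<notin> Y" "e' \<in> Y" | "e \<notin> Y" "e' \<notin> Y"
    by auto
  then show ?thesis
  proof cases
    case 1
    then obtain z where "end_vertex G e i = end_vertex G e' i'"
      "z \<in> path_image (attach G e i)" "z \<in> path_image (attach G e' i')"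
      using x by (auto simp: c c' strand_def)
    then have "e = e'" "i = i'"
      using attach_disjoint e by blast+
    then show ?thesis
      using 1 by (auto simp: c c' \<tau>_def)
  next
    case 2
    from x(1) 2 obtain z where "z \<in> path_image (attach G e i)" "x = glue H (Inl (end_vertex G e i), z)"
      unfolding c strand_def by auto
    moreover from x(2) 2 obtain w where "x = glue H (Inr e', w)"
      unfolding c' strand_def by auto
    ultimately show ?thesis
      using mixed 2(1) e(1) by metis
  next
    case 3
    from x(2) 3 obtain z where "z \<in> path_image (attach G e' i')" "x = glue H (Inl (end_vertex G e' i'), z)"
      unfolding c' strand_def by auto
    moreover from x(1) 3 obtain w where "x = glue H (Inr e, w)"
      unfolding c strand_def by auto
    ultimately show ?thesis
      using mixed 3(2) e(2) by metis
  next
    case 4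
    then have "e = e'" "height c = height c'"
      using x by (auto simp: c c' strand_def horizontal_side_def)
    then show ?thesis
      using 4 height_eq_imp[of e i j i' j'] by (simp add: c c')
  qed
qed

end

section \<open>The boundary of a state as a union of closed connected sets\<close>

context ribbon_state
begin

text \<open>The boundary of \<open>H\<close> omits only the attaching segments of edges of
  \<open>H\<close>. The open arcs of edges in \<open>Y\<close> are thus regained, which is where
  their strands run.\<close>

lemma vertex_point_in_boundary:
  assumes v: "v \<in> verts G" and z: "z \<in> sphere 0 1"
  shows "glue H (Inl v, z) \<in> surface_boundary H \<longleftrightarrow>
    (\<forall>e i. (e, i) \<in> ends G v \<longrightarrow> e \<notin> Y \<longrightarrow> z \<notin> attach G e i ` {0<..<1})"
proof -
  have "z \<in> frontier (disc (Inl v))"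
    using z by simp
  then have "glue H (Inl v, z) \<in> glue H ` (SIGMA d : disc_names H. frontier (disc d))"
    using v by (intro imageI SigmaI) auto
  then have "glue H (Inl v, z) \<in> surface_boundary H \<longleftrightarrow>
      \<not> (\<exists>e i s. e \<in> edges H \<and> 0 < s \<and> s < 1 \<and> glue H (Inl v, z) = glue H (Inr e, edge_side i s))"
    unfolding surface_boundary_def by (simp only: Diff_iff mem_Collect_eq) blast
  also have "(\<exists>e i s. e \<in> edges H \<and> 0 < s \<and> s < 1 \<and> glue H (Inl v, z) = glue H (Inr e, edge_side i s)) \<longleftrightarrow>
      (\<exists>e i. e \<in> edges G \<and> e \<notin> Y \<and> end_vertex G e i = v \<and> z \<in> attach H e i ` {0<..<1})"
    (is "?lhs \<longleftrightarrow> ?rhs")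
  proof
    assume ?lhs
    then obtain e i s where e: "e \<in> edges G" "e \<notin> Y" "0 < s" "s < 1"
      "glue H (Inl v, z) = glue H (Inr e, edge_side i s)"
      by (auto simp del: H.glue_eq_iff)
    then have "end_vertex G e i = v" "z = attach H e i s"
      by auto
    moreover have "attach H e i s \<in> attach H e i ` {0<..<1}"
      using e by (intro imageI) simp
    ultimately show ?rhs
      using e by blast
  next
    assume ?rhs
    then obtain e i s where e: "e \<in> edges G" "e \<notin> Y" "end_vertex G e i = v" "s \<in> {0<..<1}"
      "z = attach H e i s"
      by blast
    then have "glue H (Inl v, z) = glue H (Inr e, edge_side i s)"
      unfolding H.glue_eq_iff by (intro exI[of _ i] exI[of _ s]) auto
    then show ?lhs
      using e by (intro exI[of _ e] exI[of _ i] exI[of _ s]) (simp del: H.glue_eq_iff)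
  qed
  finally show ?thesis
    unfolding attach_H(2) by auto
qed

lemma edge_point_in_boundary:
  assumes e: "e \<in> edges G" "e \<notin> Y" and z: "z \<in> horizontal_side h"
  shows "glue H (Inr e, z) \<in> surface_boundary H"
proof -
  obtain u where u: "u \<in> {0..1}" "z = Complex u (of_bool h)"
    using z by (auto simp: horizontal_side_def)
  then have "z \<in> frontier (disc (Inr e))"
    by (auto simp: frontier_cbox in_cbox_complex_iff in_box_complex_iff)
  then have "glue H (Inr e, z) \<in> glue H ` (SIGMA d : disc_names H. frontier (disc d))"
    using e by (intro imageI SigmaI) auto
  \<comment> \<open>A horizontal side meets the vertical sides only at heights 0 and 1, and these
    corners of the square belong to the boundary.\<close>
  moreover have "z \<noteq> edge_side i s" if "0 < s" "s < 1" for i s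
    using that u by (auto simp: edge_side_def of_bool_def split: if_splits)
  ultimately show ?thesis
    unfolding surface_boundary_def by auto
qed

lemma boundary_cases:
  assumes x: "x \<in> surface_boundary H"
  obtains v z where "v \<in> verts G" "z \<in> sphere 0 1" "x = glue H (Inl v, z)"
  | e h z where "e \<in> edges G" "e \<notin> Y" "z \<in> horizontal_side h" "x = glue H (Inr e, z)"
proof -
  from x obtain d z where dz: "d \<in> disc_names H" "z \<in> frontier (disc d)" "x = glue H (d, z)"
    unfolding surface_boundary_def by auto
  have not_side: "x \<noteq> glue H (Inr e, edge_side i s)" if "e \<in> edges H" "0 < s" "s < 1" for e i s
    using x that unfolding surface_boundary_def by auto
  show thesis
  proof (cases d)
    case (Inl v)
    then show thesis
      using that(1)[of v z] dz by auto
  next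
    case (Inr e)
    then have e: "e \<in> edges H"
      using dz by simp
    have z: "0 \<le> Re z" "Re z \<le> 1" "0 \<le> Im z" "Im z \<le> 1" "\<not> (0 < Re z \<and> Re z < 1 \<and> 0 < Im z \<and> Im z < 1)"
      using dz(2) by (auto simp: Inr frontier_cbox in_cbox_complex_iff in_box_complex_iff)
    show thesis
    proof (cases "0 < Im z \<and> Im z < 1")
      case True
      then have "z = edge_side (Re z = 1) (Im z)"
        using z by (auto simp: edge_side_def complex_eq_iff)
      then show thesis
        using not_side[OF e, of "Im z" "Re z = 1"] True dz(3) Inr by simp
    next
      case False
      then have "z = Complex (Re z) (of_bool (Im z = 1))"
        using z by (auto simp: complex_eq_iff)
      then have "z \<in> horizontal_side (Im z = 1)"
        unfolding horizontal_side_def using z by (intro image_eqI[of _ _ "Re z"]) auto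
      then show thesis
        using that(2)[of e z] e dz(3) Inr by auto
    qed
  qed
qed

lemma strand_subset_cover_set: "fst c \<in> edges G \<Longrightarrow> strand c \<subseteq> cover_set (piece_of c)"
  by (auto simp: cover_set_def)

lemma piece_subset: "v \<in> verts G \<Longrightarrow> K \<in> pieces v \<Longrightarrow>
    K \<subseteq> sphere 0 1 - (\<Union>f\<in>ends G v. case_prod (attach G) f ` {0<..<1})"
  using Union_pieces[of v] by blast

lemma piece_avoids_open_arc:
  assumes "v \<in> verts G" "K \<in> pieces v" "z \<in> K" "(e, i) \<in> ends G v"
  shows "z \<notin> attach G e i ` {0<..<1}"
proof
  assume "z \<in> attach G e i ` {0<..<1}"
  then have "z \<in> (\<Union>f\<in>ends G v. case_prod (attach G) f ` {0<..<1})"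
    using assms(4) by (intro UN_I[of "(e, i)"]) simp_all
  then show False
    using piece_subset[OF assms(1,2)] assms(3) by blast
qed

lemma strand_subset_boundary:
  assumes "fst c \<in> edges G"
  shows "strand c \<subseteq> surface_boundary H"
proof
  fix x assume x: "x \<in> strand c"
  obtain e i j where c: "c = (e, i, j)"
    by (cases c)
  have e: "e \<in> edges G"
    using assms c by simp
  show "x \<in> surface_boundary H"
  proof (cases "e \<in> Y")
    case True
    from x True obtain z where z: "z \<in> path_image (attach G e i)" "x = glue H (Inl (end_vertex G e i), z)"
      unfolding c strand_def by auto
    have "z \<notin> attach G e' i' ` {0<..<1}" if "(e', i') \<in> ends G (end_vertex G e i)" "e' \<notin> Y" for e' i'
      using attach_disjoint[of e e' i i' z] open_arc_subset[of e' i'] that e z(1) True by auto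
    moreover have "z \<in> sphere 0 1"
      using attach_in_sphere[OF e] z(1) by blast
    ultimately show ?thesis
      unfolding z(2) using vertex_point_in_boundary[OF end_vertex_in[OF e, of i], of z] by blast
  next
    case False
    from x False obtain z where "z \<in> horizontal_side (height c)" "x = glue H (Inr e, z)"
      unfolding c strand_def by auto
    then show ?thesis
      using edge_point_in_boundary[OF e False] by simp
  qed
qed

lemma surface_boundary_eq: "surface_boundary H = (\<Union>p\<in>Pieces. cover_set p)"
proof
  show "(\<Union>p\<in>Pieces. cover_set p) \<subseteq> surface_boundary H"
  proof
    fix x assume "x \<in> (\<Union>p\<in>Pieces. cover_set p)"
    then obtain v K where vK: "v \<in> verts G" "K \<in> pieces v" "x \<in> cover_set (v, K)"
      by auto
    then consider z where "z \<in> K" "x = glue H (Inl v, z)" | c where "fst c \<in> edges G" "x \<in> strand c"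
      by (auto simp: cover_set_def)
    then show "x \<in> surface_boundary H"
    proof cases
      case 1
      then show ?thesis
        using piece_subset[OF vK(1,2)] vertex_point_in_boundary[OF vK(1), of z]
          piece_avoids_open_arc[OF vK(1,2)] by (metis Diff_iff subsetD)
    next
      case 2
      then show ?thesis
        using strand_subset_boundary by blast
    qed
  qed
  show "surface_boundary H \<subseteq> (\<Union>p\<in>Pieces. cover_set p)"
  proof
    fix x assume x: "x \<in> surface_boundary H"
    have strand: "x \<in> (\<Union>p\<in>Pieces. cover_set p)" if "fst c \<in> edges G" "x \<in> strand c" for c
      by (rule UN_I[where a = "piece_of c"])
        (fact piece_of_in[OF that(1)] subsetD[OF strand_subset_cover_set[OF that(1)] that(2)])+
    from x show "x \<in> (\<Union>p\<in>Pieces. cover_set p)"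
    proof (cases rule: boundary_cases)
      case (1 v z)
      show ?thesis
      proof (cases "z \<in> \<Union>(pieces v)")
        case True
        then obtain K where "K \<in> pieces v" "z \<in> K"
          by auto
        then have "(v, K) \<in> Pieces" "x \<in> cover_set (v, K)"
          using 1 by (auto simp: cover_set_def simp del: H.glue_eq_iff)
        then show ?thesis
          by (rule UN_I[where a = "(v, K)"])
      next
        case False
        then obtain f where f: "f \<in> ends G v" "z \<in> case_prod (attach G) f ` {0<..<1}"
          unfolding Union_pieces[OF 1(1)] using 1(2) by blast
        obtain e i where "f = (e, i)"
          by (cases f)
        with f have ei: "(e, i) \<in> ends G v" "z \<in> attach G e i ` {0<..<1}"
          by simp_all
        \<comment> \<open>The point lies on an open attaching arc and yet in the boundary, so its
          edge must have been deleted.\<close>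
        then have "e \<in> Y"
          using vertex_point_in_boundary[OF 1(1,2)] x 1(3) by metis
        moreover have "z \<in> path_image (attach G e i)"
          using ei(2) open_arc_subset by blast
        ultimately have "x \<in> strand (e, i, False)"
          using 1(3) ei(1) by (auto simp: strand_def simp del: H.glue_eq_iff)
        then show ?thesis
          using strand[of "(e, i, False)"] ei(1) by simp
      qed
    next
      case (2 e h z)
      \<comment> \<open>The end \<open>False\<close> is never reversed, so this corner has height
        \<open>h\<close> whether or not \<open>e\<close> is twisted.\<close>
      then have "x \<in> strand (e, False, h)"
        by (auto simp: strand_def height_def simp del: H.glue_eq_iff)
      then show ?thesis
        using strand[of "(e, False, h)"] 2(1) by simp
    qed
  qed
qed

lemma cover_set_closed_connected:
  assumes p: "p \<in> Pieces"
  shows "closedin (surface H) (cover_set p)" "connectedin (surface H) (cover_set p)"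
proof -
  obtain v K where vK: "p = (v, K)" "v \<in> verts G" "K \<in> pieces v"
    using p by auto
  have K: "closed K" "connected K" "K \<noteq> {}" "K \<subseteq> disc (Inl v)"
    using piece[OF vK(2,3)] piece_subset[OF vK(2,3)] by auto
  let ?A = "{c. fst c \<in> edges G \<and> piece_of c = p}"
  have "finite ?A"
    by (rule finite_subset[of _ "edges G \<times> UNIV"]) (use finite_edges in auto)
  then show "closedin (surface H) (cover_set p)"
    unfolding cover_set_def using K vK strand_closed_connected(1)
    by (intro closedin_Un closedin_Union H.closedin_surface_glue) auto
  show "connectedin (surface H) (cover_set p)"
    unfolding cover_set_def
  proof (rule connectedin_Un_UN)
    show "connectedin (surface H) (glue H ` ({Inl (fst p)} \<times> snd p))"
      using K vK by (intro H.connectedin_surface_glue) auto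
    show "strand c \<inter> glue H ` ({Inl (fst p)} \<times> snd p) \<noteq> {}" if "c \<in> ?A" for c
    proof -
      have "v = corner_vertex G c" "corner_point G c \<in> K"
        using that piece_of_eq_iff[of c v K] vK(1) by auto
      then have "glue H (Inl (corner_vertex G c), corner_point G c) \<in> glue H ` ({Inl (fst p)} \<times> snd p)"
        using vK(1) by auto
      then show ?thesis
        using corner_in_strand[of c] that by blast
    qed
  qed (use strand_closed_connected(2) K vK in auto)
qed

lemma piece_meets_strand:
  assumes p: "p \<in> Pieces" and c: "fst c \<in> edges G"
    and "glue H ` ({Inl (fst p)} \<times> snd p) \<inter> strand c \<noteq> {}"
  shows "piece_of c = p \<or> piece_of (partner \<tau> c) = p"
proof -
  obtain v K where vK: "p = (v, K)" "v \<in> verts G" "K \<in> pieces v"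
    using p by auto
  obtain z where z: "z \<in> K" "glue H (Inl v, z) \<in> strand c"
    using assms(3) vK(1) by auto
  have "z \<notin> (\<Union>f\<in>ends G v. case_prod (attach G) f ` {0<..<1})"
    using subsetD[OF piece_subset[OF vK(2,3)] z(1)] by (elim DiffE)
  then obtain c' where c': "c' = c \<or> c' = partner \<tau> c" "v = corner_vertex G c'" "z = corner_point G c'"
    using vertex_point_in_strand[OF c vK(2) _ z(2)] by blast
  moreover have "fst c' \<in> edges G"
    using c c'(1) by auto
  ultimately have "piece_of c' = p"
    using piece_of_eq_iff[of c' v K] z(1) vK by simp
  then show ?thesis
    using c'(1) by auto
qed

text \<open>Pieces are disjoint, distinct strands are disjoint, and a piece meets a strand only at a
  corner. A common point of different sets therefore lies on a strand between the two pieces, and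
  conversely that strand belongs to both sets.\<close>

lemma cover_sets_meet:
  assumes p: "p \<in> Pieces" and q: "q \<in> Pieces"
  shows "cover_set p \<inter> cover_set q \<noteq> {} \<longleftrightarrow> p = q \<or> (p, q) \<in> strands \<tau> (edges G)"
proof
  have related: "p = q \<or> (p, q) \<in> strands \<tau> (edges G)"
    if "fst c \<in> edges G" "piece_of c = p" "piece_of c = q \<or> piece_of (partner \<tau> c) = q" for c p q
    using that unfolding strands_def by auto
  have symm: "(p, q) \<in> strands \<tau> (edges G)" if "(q, p) \<in> strands \<tau> (edges G)" for p q
    using that sym_strands by (meson symD)
  assume "cover_set p \<inter> cover_set q \<noteq> {}"
  then obtain x where "x \<in> cover_set p" "x \<in> cover_set q"
    by auto
  then consider z z' where "z \<in> snd p" "z' \<in> snd q" "x = glue H (Inl (fst p), z)" "x = glue H (Inl (fst q), z')"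
    | c where "x \<in> glue H ` ({Inl (fst p)} \<times> snd p)" "fst c \<in> edges G" "piece_of c = q" "x \<in> strand c"
    | c where "x \<in> glue H ` ({Inl (fst q)} \<times> snd q)" "fst c \<in> edges G" "piece_of c = p" "x \<in> strand c"
    | c c' where "fst c \<in> edges G" "piece_of c = p" "x \<in> strand c"
      "fst c' \<in> edges G" "piece_of c' = q" "x \<in> strand c'"
    unfolding cover_set_def by (elim UnE) auto
  then show "p = q \<or> (p, q) \<in> strands \<tau> (edges G)"
  proof cases
    case 1
    then have "fst p = fst q" "z = z'"
      by auto
    then show ?thesis
      using piece_unique[of "fst p" "snd p" "snd q" z] p q 1(1,2) by (auto simp: prod_eq_iff)
  next
    case 2
    then have "piece_of c = p \<or> piece_of (partner \<tau> c) = p"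
      using piece_meets_strand[OF p, of c] by blast
    then show ?thesis
      using related[OF 2(2,3)] symm by blast
  next
    case 3
    then have "piece_of c = q \<or> piece_of (partner \<tau> c) = q"
      using piece_meets_strand[OF q, of c] by blast
    then show ?thesis
      using related[OF 3(2,3)] by blast
  next
    case 4
    then have "c' = c \<or> c' = partner \<tau> c"
      using strands_meet[of c c'] by blast
    then show ?thesis
      using related[OF 4(1,2), of q] 4(5) by blast
  qed
next
  assume "p = q \<or> (p, q) \<in> strands \<tau> (edges G)"
  then show "cover_set p \<inter> cover_set q \<noteq> {}"
  proof
    assume "p = q"
    obtain v K where "p = (v, K)" "v \<in> verts G" "K \<in> pieces v"
      using p by auto
    then show ?thesis
      using piece \<open>p = q\<close> by (auto simp: cover_set_def)
  next
    assume "(p, q) \<in> strands \<tau> (edges G)"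
    then obtain c where c: "fst c \<in> edges G" "p = piece_of c" "q = piece_of (partner \<tau> c)"
      by (auto simp: strands_def)
    then have "strand c \<subseteq> cover_set p \<inter> cover_set q"
      using strand_subset_cover_set[of c] strand_subset_cover_set[of "partner \<tau> c"]
      by (simp add: strand_partner)
    then show ?thesis
      using strand_nonempty[of c] by blast
  qed
qed

sublocale cover: closed_connected_cover "subtopology (surface H) (surface_boundary H)" Pieces cover_set
  "strands \<tau> (edges G)"
proof
  show "finite Pieces"
    by (rule finite_P)
  have sub: "cover_set p \<subseteq> surface_boundary H" if "p \<in> Pieces" for p
    using that unfolding surface_boundary_eq by blast
  show "closedin (subtopology (surface H) (surface_boundary H)) (cover_set p)" if "p \<in> Pieces" for p
    using cover_set_closed_connected(1)[OF that] sub[OF that] by (rule closedin_subset_topspace)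
  show "connectedin (subtopology (surface H) (surface_boundary H)) (cover_set p)" if "p \<in> Pieces" for p
    using cover_set_closed_connected(2)[OF that] sub[OF that] by (simp add: connectedin_subtopology)
  show "cover_set p \<noteq> {}" if "p \<in> Pieces" for p
    using cover_sets_meet[OF that that] by auto
  have "surface_boundary H \<subseteq> topspace (surface H)"
    unfolding surface_boundary_eq using cover_set_closed_connected(1) by (blast dest: closedin_subset)
  then show "topspace (subtopology (surface H) (surface_boundary H)) = (\<Union>p\<in>Pieces. cover_set p)"
    using surface_boundary_eq by (simp add: Int_absorb1)
  show "strands \<tau> (edges G) \<subseteq> Pieces \<times> Pieces"
    by (rule strands_subset)
qed (rule cover_sets_meet)

lemma num_boundary_components_eq: "num_boundary_components H = N \<tau>"
  unfolding num_boundary_components_def N_def by (rule cover.card_components)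

end

section \<open>Classes of pieces compared with components of the ribbon graph\<close>

context ribbon_pieces
begin

text \<open>The state in which all edges are deleted has the connected vertex circles as boundary components.\<close>

lemma same_vertex_related:
  assumes p: "p \<in> Pieces" and q: "q \<in> Pieces" and "fst p = fst q"
  shows "(p, q) \<in> (strands (\<lambda>_. (False, True)) (edges G))\<^sup>*"
proof -
  interpret del: ribbon_state G pieces "edges G" "{}" ..
  define v where "v = fst p"
  have v: "v \<in> verts G"
    using p by (auto simp: v_def)
  let ?S = "glue del.H ` ({Inl v} \<times> sphere 0 1)"
  have "?S \<subseteq> surface_boundary del.H"
  proof
    fix x assume "x \<in> ?S"
    then obtain z where z: "z \<in> sphere 0 1" "x = glue del.H (Inl v, z)"
      by blast
    show "x \<in> surface_boundary del.H"
      unfolding z(2) del.vertex_point_in_boundary[OF v z(1)] by simp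
  qed
  moreover have "connectedin (surface del.H) ?S"
    using v connected_sphere[of "0::complex" 1] by (intro del.H.connectedin_surface_glue) auto
  ultimately have con: "connectedin (subtopology (surface del.H) (surface_boundary del.H)) ?S"
    by (simp add: connectedin_subtopology)
  have meets: "?S \<inter> del.cover_set r \<noteq> {}" if "r \<in> Pieces" "fst r = v" for r
  proof -
    have "snd r \<in> pieces v"
      using that by auto
    then obtain z where "z \<in> snd r" "z \<in> sphere 0 1"
      using piece[OF v, of "snd r"] del.piece_subset[OF v, of "snd r"] by blast
    then have "glue del.H (Inl v, z) \<in> ?S" "glue del.H (Inl v, z) \<in> del.cover_set r"
      using that(2) unfolding del.cover_set_def by blast+
    then show ?thesis
      by blast
  qed
  have "(p, q) \<in> (strands del.\<tau> (edges G))\<^sup>*"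
    using del.cover.related_if_connected[OF con p _ q] meets p q assms(3) by (simp add: v_def)
  moreover have "strands del.\<tau> (edges G) = strands (\<lambda>_. (False, True)) (edges G)"
    by (rule strands_cong) (simp add: del.\<tau>_def)
  ultimately show ?thesis
    by simp
qed

lemma fst_piece_of [simp]: "fst (piece_of c) = corner_vertex G c"
  by (simp add: piece_of_def)

text \<open>At a vertex without edges the pieces fill the whole circle; elsewhere the piece of any
  corner will do. In this way isolated vertices are counted as well.\<close>

lemma fst_Pieces: "fst ` Pieces = verts G"
proof -
  have "pieces v \<noteq> {}" if v: "v \<in> verts G" for v
  proof (cases "ends G v = {}")
    case True
    have "(1::complex) \<in> \<Union>(pieces v)"
      unfolding Union_pieces[OF v] True by simp
    then show ?thesis
      by auto
  next
    case False
    then obtain f where "f \<in> ends G v"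
      by blast
    moreover obtain e i where "f = (e, i)"
      by (cases f)
    ultimately have "e \<in> edges G" "end_vertex G e i = v"
      by simp_all
    then show ?thesis
      using piece_of_in[of "(e, i, True)"] fst_piece_of[of "(e, i, True)"]
      by (cases "piece_of (e, i, True)") auto
  qed
  then show ?thesis
    by force
qed

lemma fst_strands:
  assumes "(p, q) \<in> strands \<sigma> (edges G)"
  shows "(fst p, fst q) \<in> (edge_rel G)\<^sup>*"
proof -
  obtain e i j where c: "e \<in> edges G" "p = piece_of (e, i, j)" "q = piece_of (partner \<sigma> (e, i, j))"
    using assms by (auto simp: strands_def)
  then have "(fst p, fst q) \<in> edge_rel G"
    unfolding edge_rel_def by (simp del: split_paired_Ex) blast
  then show ?thesis ..
qed

text \<open>The corners of a strand belong to one edge, so sending pieces to vertices induces a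
  surjection from classes of pieces to components: every component has some boundary.\<close>

lemma num_components_le_N: "num_components G \<le> N \<sigma>"
  unfolding num_components_eq N_def
  by (rule card_quotient_rtrancl_le[where f = fst])
    (use fst_Pieces fst_strands sym_edge_rel finite_P in auto)

text \<open>If every edge has its four corners related, the relation absorbs the strands of any
  other state, in particular of the state with all edges deleted, which links the pieces at each
  vertex. Walks between vertices then lift to pieces.\<close>

lemma N_eq_num_components:
  assumes rel: "\<And>e c c'. e \<in> edges G \<Longrightarrow> (piece_of (e, c), piece_of (e, c')) \<in> (strands \<sigma> (edges G))\<^sup>*"
  shows "N \<sigma> = num_components G"
proof -
  let ?R = "(strands \<sigma> (edges G))\<^sup>*"
  have "strands (\<lambda>_. (False, True)) (edges G) \<subseteq> ?R"
    using rel by (auto simp: strands_def)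
  then have "(strands (\<lambda>_. (False, True)) (edges G))\<^sup>* \<subseteq> ?R"
    by (rule rtrancl_subset_rtrancl)
  then have same: "(p, q) \<in> ?R" if "p \<in> Pieces" "q \<in> Pieces" "fst p = fst q" for p q
    using same_vertex_related[OF that] by blast
  have "(p, q) \<in> ?R" if p: "p \<in> Pieces" and q: "q \<in> Pieces" and "(fst p, fst q) \<in> (edge_rel G)\<^sup>*" for p q
  proof -
    \<comment> \<open>The induction treats all pieces at the vertex reached at once. The pieces of
      \<open>(e, i, False)\<close> and \<open>(e, i', False)\<close> are the stepping stones across
      an edge.\<close>
    have "\<forall>q\<in>Pieces. fst q = w \<longrightarrow> (p, q) \<in> ?R" if "(fst p, w) \<in> (edge_rel G)\<^sup>*" for w
      using that
    proof induction
      case base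
      then show ?case
        using same[OF p] by auto
    next
      case (step u w)
      then obtain e i i' where e: "e \<in> edges G" "u = end_vertex G e i" "w = end_vertex G e i'"
        by (auto simp: edge_rel_def)
      have in': "piece_of (e, k, False) \<in> Pieces" for k
        using piece_of_in[of "(e, k, False)"] e(1) by simp
      have "(p, piece_of (e, i, False)) \<in> ?R"
        using bspec[OF step.IH in'[of i]] e(2) by simp
      moreover have "(piece_of (e, i, False), piece_of (e, i', False)) \<in> ?R"
        using rel e(1) by blast
      ultimately have p': "(p, piece_of (e, i', False)) \<in> ?R"
        by (rule rtrancl_trans)
      show ?case
      proof (intro ballI impI)
        fix q assume "q \<in> Pieces" "fst q = w"
        then have "(piece_of (e, i', False), q) \<in> ?R"
          using same[OF in', of q i'] e(3) by simp
        with p' show "(p, q) \<in> ?R"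
          by (rule rtrancl_trans)
      qed
    qed
    then show ?thesis
      using that by blast
  qed
  then show ?thesis
    unfolding num_components_eq N_def
    by (intro card_quotient_rtrancl_eq[where f = fst])
      (use fst_Pieces fst_strands sym_edge_rel sym_strands in auto)
qed

end

section \<open>Transversals and the transition polynomials\<close>

text \<open>\<open>Hat\<close> is also the default at \<open>(False, False)\<close>; injectivity is
  claimed for nonzero states only.\<close>

definition state_element :: "bool \<times> bool \<Rightarrow> 'e \<Rightarrow> 'e element" where
  "state_element s e = (if s = (True, False) then Dot e else if s = (False, True) then Bar e else Hat e)"

text \<open>Edges in neither set receive the state of \<open>Dot\<close>. The value is therefore
  nonzero everywhere, also outside the edge set, and the function is \<open>valid\<close>.\<close>

definition state_of :: "'e set \<Rightarrow> 'e set \<Rightarrow> 'e \<Rightarrow> bool \<times> bool" where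
  "state_of Y Z e = (if e \<in> Y then (False, True) else if e \<in> Z then (True, True) else (True, False))"

lemma state_of_nonzero: "state_of Y Z e \<noteq> (False, False)"
  by (simp add: state_of_def)

lemma state_transversal_eq_image:
  assumes "(X, Y, Z) \<in> ordered_tripartitions E"
  shows "state_transversal X Y Z = (\<lambda>e. state_element (state_of Y Z e) e) ` E"
  using assms unfolding state_transversal_def ordered_tripartitions_def state_element_def state_of_def
  by (auto simp: image_iff)

lemma exists_tripartition:
  assumes "\<And>e. \<sigma> e \<noteq> (False, False)"
  obtains X Y Z where "(X, Y, Z) \<in> ordered_tripartitions E" "\<And>e. e \<in> E \<Longrightarrow> state_of Y Z e = \<sigma> e"
proof
  show "({e \<in> E. \<sigma> e = (True, False)}, {e \<in> E. \<sigma> e = (False, True)}, {e \<in> E. \<sigma> e = (True, True)})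
      \<in> ordered_tripartitions E"
    using assms unfolding ordered_tripartitions_def by (auto simp: set_eq_iff) (metis surj_pair)
  show "state_of {e \<in> E. \<sigma> e = (False, True)} {e \<in> E. \<sigma> e = (True, True)} e = \<sigma> e" if "e \<in> E" for e
    using assms[of e] that by (cases "\<sigma> e") (auto simp: state_of_def)
qed

lemma state_element_eq_iff:
  assumes "s \<noteq> (False, False)" "s' \<noteq> (False, False)"
  shows "state_element s e = state_element s' e' \<longleftrightarrow> e = e' \<and> s = s'"
  using assms by (cases s; cases s') (auto simp: state_element_def split: if_splits)

lemma card_state_transversal:
  assumes "(X, Y, Z) \<in> ordered_tripartitions E"
  shows "card (state_transversal X Y Z) = card E"
  unfolding state_transversal_eq_image[OF assms]
  by (rule card_image) (simp add: inj_on_def state_element_eq_iff state_of_nonzero)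

text \<open>Two transversals share an element exactly at the edges with equal states. This
  translates ranks into Hamming distances between states.\<close>

lemma card_state_transversal_Int:
  assumes "finite E" "(X, Y, Z) \<in> ordered_tripartitions E" "(X', Y', Z') \<in> ordered_tripartitions E"
  shows "card (state_transversal X Y Z \<inter> state_transversal X' Y' Z') =
    card E - card {e \<in> E. state_of Y Z e \<noteq> state_of Y' Z' e}"
proof -
  let ?D = "{e \<in> E. state_of Y Z e \<noteq> state_of Y' Z' e}"
  have "state_transversal X Y Z \<inter> state_transversal X' Y' Z' =
      (\<lambda>e. state_element (state_of Y Z e) e) ` (E - ?D)"
    unfolding state_transversal_eq_image[OF assms(2)] state_transversal_eq_image[OF assms(3)]
  proof (intro set_eqI iffI)
    fix u
    assume "u \<in> (\<lambda>e. state_element (state_of Y Z e) e) ` E \<inter> (\<lambda>e. state_element (state_of Y' Z' e) e) ` E"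
    then obtain e e' where "e \<in> E" "u = state_element (state_of Y Z e) e" "u = state_element (state_of Y' Z' e') e'"
      by blast
    then show "u \<in> (\<lambda>e. state_element (state_of Y Z e) e) ` (E - ?D)"
      by (intro image_eqI[of _ _ e]) (auto simp: state_element_eq_iff state_of_nonzero)
  next
    fix u
    assume "u \<in> (\<lambda>e. state_element (state_of Y Z e) e) ` (E - ?D)"
    then obtain e where "e \<in> E" "state_of Y Z e = state_of Y' Z' e" "u = state_element (state_of Y Z e) e"
      by blast
    then show "u \<in> (\<lambda>e. state_element (state_of Y Z e) e) ` E \<inter> (\<lambda>e. state_element (state_of Y' Z' e) e) ` E"
      by (intro IntI image_eqI[of _ _ e]) simp_all
  qed
  also have "card \<dots> = card (E - ?D)"
    by (rule card_image) (simp add: inj_on_def state_element_eq_iff state_of_nonzero)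
  finally show ?thesis
    using assms(1) by (simp add: card_Diff_subset)
qed

lemma inj_on_state_transversal:
  "inj_on (\<lambda>(X, Y, Z). state_transversal X Y Z) (ordered_tripartitions E)"
proof (rule inj_onI)
  fix p q :: "'a set \<times> 'a set \<times> 'a set"
  assume eq: "(case p of (X, Y, Z) \<Rightarrow> state_transversal X Y Z) =
    (case q of (X, Y, Z) \<Rightarrow> state_transversal X Y Z)"
  obtain X Y Z X' Y' Z' where p: "p = (X, Y, Z)" and q: "q = (X', Y', Z')"
    by (cases p; cases q)
  have "Dot e \<in> state_transversal X Y Z \<longleftrightarrow> e \<in> X" "Bar e \<in> state_transversal X Y Z \<longleftrightarrow> e \<in> Y"
    "Hat e \<in> state_transversal X Y Z \<longleftrightarrow> e \<in> Z" for e and X Y Z :: "'a set"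
    by (auto simp: state_transversal_def)
  from this[of _ X Y Z] this[of _ X' Y' Z'] show "p = q"
    using eq by (auto simp: p q)
qed

text \<open>A set of elements is determined by the edges at which it contains \<open>Dot\<close>,
  \<open>Bar\<close> or \<open>Hat\<close>; one element per skew class says that these three sets
  partition the edges.\<close>

lemma transversals_ribbon_multimatroid:
  fixes G :: "('v, 'e) ribbon_graph"
  shows "transversals (ribbon_multimatroid G) =
    (\<lambda>(X, Y, Z). state_transversal X Y Z) ` ordered_tripartitions (edges G)"
proof -
  have card3: "card (T \<inter> {Dot e, Bar e, Hat e}) =
      of_bool (Dot e \<in> T) + of_bool (Bar e \<in> T) + of_bool (Hat e \<in> T)" for T and e :: 'e
    by (auto simp: Int_insert_right)
  show ?thesis
  proof (intro set_eqI iffI)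
    fix T assume "T \<in> transversals (ribbon_multimatroid G)"
    then have T: "T \<subseteq> (\<Union>e\<in>edges G. {Dot e, Bar e, Hat e})"
      and one: "\<forall>e\<in>edges G. card (T \<inter> {Dot e, Bar e, Hat e}) = 1"
      by (simp_all add: transversals_def ribbon_multimatroid_def)
    define X Y Z where "X = {e. Dot e \<in> T}" and "Y = {e. Bar e \<in> T}" and "Z = {e. Hat e \<in> T}"
    have sub: "X \<subseteq> edges G" "Y \<subseteq> edges G" "Z \<subseteq> edges G"
      using T by (auto simp: X_def Y_def Z_def)
    have one': "(e \<in> X \<and> e \<notin> Y \<and> e \<notin> Z) \<or> (e \<notin> X \<and> e \<in> Y \<and> e \<notin> Z) \<or> (e \<notin> X \<and> e \<notin> Y \<and> e \<in> Z)"
      if "e \<in> edges G" for e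
    proof -
      have "of_bool (Dot e \<in> T) + of_bool (Bar e \<in> T) + of_bool (Hat e \<in> T) = (1::nat)"
        using one that by (simp only: card3[symmetric])
      then show ?thesis
        by (cases "Dot e \<in> T"; cases "Bar e \<in> T"; cases "Hat e \<in> T") (simp_all add: X_def Y_def Z_def)
    qed
    have "(X, Y, Z) \<in> ordered_tripartitions (edges G)"
      using sub one' unfolding ordered_tripartitions_def by blast
    moreover have "u \<in> T \<longleftrightarrow> u \<in> state_transversal X Y Z" for u
      by (cases u) (auto simp: state_transversal_def X_def Y_def Z_def)
    then have "T = state_transversal X Y Z"
      by blast
    ultimately show "T \<in> (\<lambda>(X, Y, Z). state_transversal X Y Z) ` ordered_tripartitions (edges G)"
      by (intro image_eqI[of _ _ "(X, Y, Z)"]) simp_all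
  next
    fix T assume "T \<in> (\<lambda>(X, Y, Z). state_transversal X Y Z) ` ordered_tripartitions (edges G)"
    then obtain X Y Z where *: "(X, Y, Z) \<in> ordered_tripartitions (edges G)" "T = state_transversal X Y Z"
      by auto
    then have m: "Dot e \<in> T \<longleftrightarrow> e \<in> X" "Bar e \<in> T \<longleftrightarrow> e \<in> Y" "Hat e \<in> T \<longleftrightarrow> e \<in> Z" for e
      by (auto simp: state_transversal_def)
    have "card (T \<inter> {Dot e, Bar e, Hat e}) = 1" if "e \<in> edges G" for e
      unfolding card3 m using that *(1) by (auto simp: ordered_tripartitions_def)
    moreover have "T \<subseteq> (\<Union>e\<in>edges G. {Dot e, Bar e, Hat e})"
      using * by (auto simp: state_transversal_def ordered_tripartitions_def)
    ultimately show "T \<in> transversals (ribbon_multimatroid G)"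
      unfolding transversals_def ribbon_multimatroid_def by auto
  qed
qed

section \<open>Nullity as the distance to the nearest basis\<close>

context ribbon_pieces
begin

lemma state_boundary_components_eq: "state_boundary_components G Y Z = N (state_of Y Z)"
proof -
  interpret st: ribbon_state G pieces Y Z ..
  have "st.\<tau> = state_of Y Z"
    by (simp add: fun_eq_iff st.\<tau>_def state_of_def)
  then show ?thesis
    using st.num_boundary_components_eq by (simp add: state_boundary_components_def st.H_def)
qed

lemma N_cong: "(\<And>e. e \<in> edges G \<Longrightarrow> \<sigma> e = \<sigma>' e) \<Longrightarrow> N \<sigma> = N \<sigma>'"
  unfolding N_def by (simp add: strands_cong[of "edges G" \<sigma> \<sigma>'])

text \<open>The rank is the number of edges minus the distance to the nearest basis. Each changed
  edge shifts \<open>N\<close> by at most one, so the distance is at least \<open>?n\<close>, and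
  the closest state found by descent attains it.\<close>

lemma state_boundary_components_eq_nullity:
  assumes T: "(X, Y, Z) \<in> ordered_tripartitions (edges G)"
  shows "state_boundary_components G Y Z =
    num_components G + mm_nullity (ribbon_multimatroid G) (state_transversal X Y Z)"
proof -
  let ?E = "edges G" and ?k = "num_components G" and ?T = "state_transversal X Y Z"
  let ?M = "ribbon_multimatroid G"
  let ?n = "N (state_of Y Z) - ?k"
  have valid: "valid (state_of Y Z)" for Y Z
    by (simp add: valid_def state_of_nonzero)
  have bases: "B \<in> bases ?M \<longleftrightarrow> (\<exists>X' Y' Z'. (X', Y', Z') \<in> ordered_tripartitions ?E \<and>
      N (state_of Y' Z') = ?k \<and> B = state_transversal X' Y' Z')" for B
    by (auto simp: ribbon_multimatroid_def state_boundary_components_eq)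
  have upper: "card (B \<inter> ?T) \<le> card ?E - ?n" if "B \<in> bases ?M" for B
  proof -
    from that[unfolded bases] obtain X' Y' Z' where B: "(X', Y', Z') \<in> ordered_tripartitions ?E"
      "N (state_of Y' Z') = ?k" "B = state_transversal X' Y' Z'"
      by (elim exE conjE)
    have "N (state_of Y Z) \<le> ?k + card {e \<in> ?E. state_of Y Z e \<noteq> state_of Y' Z' e}"
      using N_le_card_diff[OF valid valid, of Y Z Y' Z'] B(2) by simp
    moreover have "card (B \<inter> ?T) = card ?E - card {e \<in> ?E. state_of Y Z e \<noteq> state_of Y' Z' e}"
      using card_state_transversal_Int[OF finite_edges T B(1)] B(3) by (simp add: Int_commute)
    ultimately show ?thesis
      by linarith
  qed
  obtain \<sigma> where \<sigma>: "valid \<sigma>" "N \<sigma> = ?k" "card {e \<in> ?E. \<sigma> e \<noteq> state_of Y Z e} \<le> ?n"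
    using exists_closest_state[OF valid num_components_le_N N_eq_num_components] by blast
  obtain X' Y' Z' where B: "(X', Y', Z') \<in> ordered_tripartitions ?E"
    "\<And>e. e \<in> ?E \<Longrightarrow> state_of Y' Z' e = \<sigma> e"
    using exists_tripartition[of \<sigma> ?E] \<sigma>(1) unfolding valid_def by metis
  let ?B = "state_transversal X' Y' Z'"
  have NB: "N (state_of Y' Z') = ?k"
    using N_cong[of "state_of Y' Z'" \<sigma>] B(2) \<sigma>(2) by simp
  have B_base: "?B \<in> bases ?M"
    unfolding bases by (intro exI[of _ X'] exI[of _ Y'] exI[of _ Z'] conjI B(1) NB refl)
  have "{e \<in> ?E. state_of Y' Z' e \<noteq> state_of Y Z e} = {e \<in> ?E. \<sigma> e \<noteq> state_of Y Z e}"
    using B(2) by auto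
  then have "card (?B \<inter> ?T) \<ge> card ?E - ?n"
    using card_state_transversal_Int[OF finite_edges B(1) T] \<sigma>(3) by simp
  then have attained: "card (?B \<inter> ?T) = card ?E - ?n"
    using upper[OF B_base] by simp
  have "mm_rank ?M ?T = card ?E - ?n"
    unfolding mm_rank_def
  proof (rule Max_eqI)
    have "{card (B \<inter> ?T) |B. B \<in> bases ?M} \<subseteq> {..card ?E}"
      using upper by fastforce
    then show "finite {card (B \<inter> ?T) |B. B \<in> bases ?M}"
      by (rule finite_subset) simp
    show "card ?E - ?n \<in> {card (B \<inter> ?T) |B. B \<in> bases ?M}"
      using attained B_base by (metis (mono_tags, lifting) mem_Collect_eq)
  qed (use upper in auto)
  \<comment> \<open>Rank and nullity are truncated differences; this bound makes
    \<open>card ?E - (card ?E - ?n)\<close> return \<open>?n\<close>.\<close>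
  moreover have "?n \<le> card ?E"
  proof -
    have "N (state_of Y Z) \<le> ?k + card {e \<in> ?E. state_of Y Z e \<noteq> \<sigma> e}"
      using N_le_card_diff[OF valid \<sigma>(1), of Y Z] \<sigma>(2) by simp
    moreover have "card {e \<in> ?E. state_of Y Z e \<noteq> \<sigma> e} \<le> card ?E"
      by (rule card_mono) (use finite_edges in auto)
    ultimately show ?thesis
      by linarith
  qed
  ultimately have "mm_nullity ?M ?T = ?n"
    by (simp add: mm_nullity_def card_state_transversal[OF T])
  then show ?thesis
    using num_components_le_N[of "state_of Y Z"] by (simp add: state_boundary_components_eq)
qed

end

lemma prod_state_transversal:
  fixes x :: "'e element \<Rightarrow> 'r::comm_ring_1"
  assumes "finite X" "finite Y" "finite Z"
  shows "(\<Prod>u\<in>state_transversal X Y Z. x u) = (\<Prod>e\<in>X. x (Dot e)) * (\<Prod>e\<in>Y. x (Bar e)) * (\<Prod>e\<in>Z. x (Hat e))"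
proof -
  have "(\<Prod>u\<in>state_transversal X Y Z. x u) = prod x (Dot ` X \<union> Bar ` Y) * prod x (Hat ` Z)"
    unfolding state_transversal_def using assms by (intro prod.union_disjoint) auto
  also have "prod x (Dot ` X \<union> Bar ` Y) = prod x (Dot ` X) * prod x (Bar ` Y)"
    using assms by (intro prod.union_disjoint) auto
  finally show ?thesis
    by (simp add: prod.reindex inj_on_def)
qed

theorem theorem6p6:
  fixes G :: "('v, 'e) ribbon_graph"
    and \<alpha> \<beta> \<gamma> :: "'e \<Rightarrow> 'r::comm_ring_1"
    and x :: "'e element \<Rightarrow> 'r"
    and t :: 'r
  assumes "is_ribbon_graph G"
    and "\<And>e. e \<in> edges G \<Longrightarrow> \<alpha> e = x (Dot e)"
    and "\<And>e. e \<in> edges G \<Longrightarrow> \<beta> e = x (Bar e)"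
    and "\<And>e. e \<in> edges G \<Longrightarrow> \<gamma> e = x (Hat e)"
  shows "ribbon_transition_poly G \<alpha> \<beta> \<gamma> t =
    t ^ num_components G * weighted_transition_poly (ribbon_multimatroid G) x t"
proof -
  interpret ribbon G
    by unfold_locales (rule assms(1))
  obtain pieces where "ribbon_pieces G pieces"
    using exists_pieces by blast
  then interpret ribbon_pieces G pieces .
  let ?M = "ribbon_multimatroid G"
  \<comment> \<open>\<open>state_transversal\<close> maps tripartitions bijectively to transversals,
    so both sums can be compared term by term.\<close>
  have "weighted_transition_poly ?M x t = (\<Sum>(X, Y, Z)\<in>ordered_tripartitions (edges G).
      t ^ mm_nullity ?M (state_transversal X Y Z) * (\<Prod>u\<in>state_transversal X Y Z. x u))"
    unfolding weighted_transition_poly_def transversals_ribbon_multimatroid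
    by (subst sum.reindex[OF inj_on_state_transversal]) (simp add: split_def o_def)
  then have "t ^ num_components G * weighted_transition_poly ?M x t =
    (\<Sum>(X, Y, Z)\<in>ordered_tripartitions (edges G). t ^ num_components G *
      (t ^ mm_nullity ?M (state_transversal X Y Z) * (\<Prod>u\<in>state_transversal X Y Z. x u)))"
    by (simp add: sum_distrib_left split_def)
  also have "\<dots> = ribbon_transition_poly G \<alpha> \<beta> \<gamma> t"
    unfolding ribbon_transition_poly_def
  proof (rule sum.cong[OF refl], clarify)
    fix X Y Z assume XYZ: "(X, Y, Z) \<in> ordered_tripartitions (edges G)"
    then have sub: "X \<subseteq> edges G" "Y \<subseteq> edges G" "Z \<subseteq> edges G"
      by (auto simp: ordered_tripartitions_def)
    then have fin: "finite X" "finite Y" "finite Z"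
      using finite_edges finite_subset by blast+
    have "prod \<alpha> X = (\<Prod>e\<in>X. x (Dot e))" "prod \<beta> Y = (\<Prod>e\<in>Y. x (Bar e))"
      "prod \<gamma> Z = (\<Prod>e\<in>Z. x (Hat e))"
      using sub assms(2-4) by (auto intro!: prod.cong)
    then show "t ^ num_components G *
        (t ^ mm_nullity ?M (state_transversal X Y Z) * (\<Prod>u\<in>state_transversal X Y Z. x u)) =
      prod \<alpha> X * prod \<beta> Y * prod \<gamma> Z * t ^ state_boundary_components G Y Z"
      unfolding state_boundary_components_eq_nullity[OF XYZ]
      by (simp add: prod_state_transversal[OF fin] power_add mult_ac)
  qed
  finally show ?thesis ..
qed

end
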